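(* Let $\mathbb{F}$ be any field, let $G$ be any finite group, and let $V = \mathbb{F}^n$ with $n \geq 1$ be any finite-dimensional faithful $\mathbb{F}G$-module. Let $W$ be any irreducible $\mathbb{F}G$-module. Then there is an integer $m$ with $1 \leq m \leq |G|$ (depending on $W$) such that all of the following statements hold for this $m$: (i) $W$ is isomorphic to an $\mathbb{F}G$-submodule of $\mathrm{Sym}^m(V)$. (ii) $W$ is isomorphic to a quotient $\mathbb{F}G$-module of $\mathrm{Sym}^m(V)$. (iii) For every integer $k \geq 0$, $W$ is isomorphic to an $\mathbb{F}G$-submodule of $\mathrm{Sym}^{m+k|G|}(V)$, and also to a quotient $\mathbb{F}G$-module of $\mathrm{Sym}^{m+k|G|}(V)$.
   Context: An $\mathbb{F}G$-module is faithful if the corresponding homomorphism $G \to \mathrm{GL}(V)$ is injective. $\mathrm{Sym}^m(V)$ denotes the $m$-th symmetric power of $V$, with the $G$-action induced from $V$: fixing a basis $(x_1,\ldots,x_n)$ of $V$, it is identified with the space of homogeneous polynomials of degree $m$ in the variables $x_1,\ldots,x_n$, where $G$ acts by the algebra automorphisms of $\mathbb{F}[x_1,\ldots,x_n]$ extending its linear action on $V = \langle x_1,\ldots,x_n\rangle_{\mathbb{F}}$. The field $\mathbb{F}$ need not be algebraically closed, and its characteristic is allowed to divide $|G|$. *)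

theory Defs
  imports
    "HOL-Library.Poly_Mapping"
    "HOL-Algebra.Group_Action"
    "HOL-Algebra.QuotRing"
    "Jordan_Normal_Form.VS_Connect"
begin

section \<open>Modules over a group algebra\<close>

text \<open>
  A module over the group algebra of \<open>G\<close> over \<open>K\<close> is a \<open>K\<close>-vector space record together with
  the action of the group elements.  As usual for \<^locale>\<open>group_action\<close>, each \<open>act V g\<close> is
  an extensional function on \<open>carrier V\<close> (it is \<open>undefined\<close> outside), so that \<open>act V\<close> is a
  group homomorphism into \<open>BijGroup (carrier V)\<close>; this is why the actions below are restricted.
\<close>

record ('a, 'g, 'v) fg_module = "('a, 'v) module" +
  act :: "'g \<Rightarrow> 'v \<Rightarrow> 'v"

locale FG_module =
  vectorspace K V + group_action G "carrier V" "act V"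
  for K :: "('a, 'k) ring_scheme" and G :: "('g, 'h) monoid_scheme"
    and V :: "('a, 'g, 'v, 'm) fg_module_scheme" +
  assumes act_linear: "g \<in> carrier G \<Longrightarrow> act V g \<in> LinearCombinations.module_hom K V V"

locale faithful_FG_module =
  FG_module K G V + faithful_action G "carrier V" "act V"
  for K :: "('a, 'k) ring_scheme" and G :: "('g, 'h) monoid_scheme"
    and V :: "('a, 'g, 'v, 'm) fg_module_scheme"

definition FG_submodule ::
  "('a, 'k) ring_scheme \<Rightarrow> ('g, 'h) monoid_scheme \<Rightarrow> 'v set \<Rightarrow>
   ('a, 'g, 'v, 'm) fg_module_scheme \<Rightarrow> bool" where
  "FG_submodule K G U V \<longleftrightarrow>
     subspace K U V \<and> (\<forall>g\<in>carrier G. \<forall>u\<in>U. act V g u \<in> U)"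

locale irreducible_FG_module =
  FG_module K G V
  for K :: "('a, 'k) ring_scheme" and G :: "('g, 'h) monoid_scheme"
    and V :: "('a, 'g, 'v, 'm) fg_module_scheme" +
  assumes nonzero: "carrier V \<noteq> {\<zero>\<^bsub>V\<^esub>}"
    and irreducible: "FG_submodule K G U V \<Longrightarrow> U = {\<zero>\<^bsub>V\<^esub>} \<or> U = carrier V"

definition sub_FG ::
  "('a, 'g, 'v, 'm) fg_module_scheme \<Rightarrow> 'v set \<Rightarrow> ('a, 'g, 'v, 'm) fg_module_scheme" where
  "sub_FG V U = V\<lparr>carrier := U, act := (\<lambda>g. \<lambda>u\<in>U. act V g u)\<rparr>"

text \<open>
  Elements of the quotient are the additive cosets of \<open>U\<close>.  As in \<^const>\<open>FactRing\<close>, operations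
  on a coset \<open>A\<close> are given by the union over all representatives \<open>x \<in> A\<close> of the coset of the
  result.  These cosets all coincide when \<open>U\<close> is a submodule.
\<close>

definition quot_FG ::
  "('a, 'g, 'v, 'm) fg_module_scheme \<Rightarrow> 'v set \<Rightarrow> ('a, 'g, 'v set) fg_module" where
  "quot_FG V U =
     \<lparr>carrier = a_rcosets\<^bsub>V\<^esub> U, mult = undefined, one = undefined, zero = U, add = set_add V,
      smult = (\<lambda>c A. \<Union>x\<in>A. U +>\<^bsub>V\<^esub> (c \<odot>\<^bsub>V\<^esub> x)),
      act = (\<lambda>g. \<lambda>A\<in>a_rcosets\<^bsub>V\<^esub> U. \<Union>x\<in>A. U +>\<^bsub>V\<^esub> act V g x)\<rparr>"

definition FG_iso ::
  "('a, 'k) ring_scheme \<Rightarrow> ('g, 'h) monoid_scheme \<Rightarrow> ('a, 'g, 'v, 'm) fg_module_scheme \<Rightarrow>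
   ('a, 'g, 'w, 'n) fg_module_scheme \<Rightarrow> bool" where
  "FG_iso K G V W \<longleftrightarrow>
     (\<exists>f \<in> LinearCombinations.module_hom K V W. bij_betw f (carrier V) (carrier W) \<and>
        (\<forall>g\<in>carrier G. \<forall>v\<in>carrier V. f (act V g v) = act W g (f v)))"

definition iso_to_submodule ::
  "('a, 'k) ring_scheme \<Rightarrow> ('g, 'h) monoid_scheme \<Rightarrow> ('a, 'g, 'w, 'n) fg_module_scheme \<Rightarrow>
   ('a, 'g, 'v, 'm) fg_module_scheme \<Rightarrow> bool" where
  "iso_to_submodule K G W V \<longleftrightarrow> (\<exists>U. FG_submodule K G U V \<and> FG_iso K G W (sub_FG V U))"

definition iso_to_quotient ::
  "('a, 'k) ring_scheme \<Rightarrow> ('g, 'h) monoid_scheme \<Rightarrow> ('a, 'g, 'w, 'n) fg_module_scheme \<Rightarrow>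
   ('a, 'g, 'v, 'm) fg_module_scheme \<Rightarrow> bool" where
  "iso_to_quotient K G W V \<longleftrightarrow> (\<exists>U. FG_submodule K G U V \<and> FG_iso K G W (quot_FG V U))"


section \<open>Symmetric powers\<close>

definition vec_FG :: "nat \<Rightarrow> ('g \<Rightarrow> 'a vec \<Rightarrow> 'a vec) \<Rightarrow> ('a::field, 'g, 'a vec) fg_module" where
  "vec_FG n \<rho> = module.extend (module_vec TYPE('a) n) (fg_module.fields \<rho>)"

text \<open>
  Polynomials are finitely supported maps from exponent vectors to coefficients.  The variables
  are indexed by natural numbers; those of index below \<open>n\<close> are the standard basis of
  the \<open>n\<close>-dimensional space of column vectors.
\<close>

type_synonym 'a mpol = "(nat \<Rightarrow>\<^sub>0 nat) \<Rightarrow>\<^sub>0 'a"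

definition Const :: "'a::zero \<Rightarrow> 'a mpol" where
  "Const c = Poly_Mapping.single 0 c"

definition Var :: "nat \<Rightarrow> 'a::zero_neq_one mpol" where
  "Var i = Poly_Mapping.single (Poly_Mapping.single i 1) 1"

definition homogeneous_polys :: "nat \<Rightarrow> nat \<Rightarrow> 'a::zero mpol set" where
  "homogeneous_polys n m =
     {p. \<forall>t\<in>Poly_Mapping.keys p. Poly_Mapping.keys t \<subseteq> {..<n} \<and>
           (\<Sum>i<n. Poly_Mapping.lookup t i) = m}"

definition linear_form :: "nat \<Rightarrow> 'a::field vec \<Rightarrow> 'a mpol" where
  "linear_form n v = (\<Sum>i<n. Const (v $ i) * Var i)"

text \<open>The algebra endomorphism that maps each variable \<open>Var i\<close> to \<open>\<sigma> i\<close>.\<close>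

definition subst_vars :: "(nat \<Rightarrow> 'a mpol) \<Rightarrow> 'a mpol \<Rightarrow> 'a::comm_ring_1 mpol" where
  "subst_vars \<sigma> p =
     (\<Sum>t\<in>Poly_Mapping.keys p. Const (Poly_Mapping.lookup p t) *
        (\<Prod>i\<in>Poly_Mapping.keys t. \<sigma> i ^ Poly_Mapping.lookup t i))"

definition Sym_FG ::
  "nat \<Rightarrow> nat \<Rightarrow> ('a, 'g, 'a vec, 'm) fg_module_scheme \<Rightarrow> ('a::field, 'g, 'a mpol) fg_module" where
  "Sym_FG n m V =
     \<lparr>carrier = homogeneous_polys n m, mult = undefined, one = undefined, zero = 0, add = (+),
      smult = (\<lambda>c p. Const c * p),
      act = (\<lambda>g. \<lambda>p\<in>homogeneous_polys n m.
               subst_vars (\<lambda>i. linear_form n (act V g (unit_vec n i))) p)\<rparr>"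

end

theory Submission
  imports Defs
begin

text \<open>
  Let \<open>Z\<close> be the subgroup of the elements of \<open>G\<close> that act on \<open>V\<close> as scalars, and \<open>\<chi>\<close> the character
  by which they do; faithfulness makes \<open>\<chi>\<close> injective, so \<open>card Z\<close> is invertible in the field.
  Elements of \<open>G\<close> from different cosets of \<open>Z\<close> act on linear forms by projectively distinct maps,
  so Dedekind's elimination argument, in which each step multiplies by a linear form and removes one
  coset, shows: if \<open>m + 1\<close> is at least the number of cosets and \<open>c\<close> transforms
  under \<open>Z\<close> by \<open>\<chi>\<^sup>-\<^sup>m\<close>, then \<open>\<Sum>g. c g * g f\<close> is nonzero for some \<open>f\<close> in \<open>Sym\<^sup>m V\<close>.

  Averaging over \<open>Z\<close> gives, in every window of \<open>card Z\<close> consecutive degrees \<open>m\<close>, one for which \<open>W\<close>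
  contains a nonzero \<open>w\<close> with \<open>z w = \<chi>(z)\<^sup>m w\<close> on \<open>Z\<close>.  For a functional \<open>l\<close> with \<open>l w = 1\<close> apply the above
  to \<open>c g = l (g\<^sup>-\<^sup>1 w)\<close>.  The sum being nonzero means both that \<open>v \<mapsto> \<Sum>g. l (g\<^sup>-\<^sup>1 v) * g f\<close> is a nonzero
  equivariant map from \<open>W\<close> to \<open>Sym\<^sup>m V\<close>, and that \<open>p \<mapsto> \<Sum>g. coeff\<^sub>t (g p) * g\<^sup>-\<^sup>1 w\<close> is a nonzero one from \<open>Sym\<^sup>m V\<close>
  to \<open>W\<close> for a suitable monomial \<open>t\<close>.  Irreducibility does the rest.
\<close>

section \<open>Substitution and homogeneous polynomials\<close>

abbreviation monom_value :: "(nat \<Rightarrow> 'a mpol) \<Rightarrow> (nat \<Rightarrow>\<^sub>0 nat) \<Rightarrow> 'a::comm_ring_1 mpol" where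
  "monom_value \<sigma> t \<equiv> \<Prod>i\<in>Poly_Mapping.keys t. \<sigma> i ^ Poly_Mapping.lookup t i"

lemma poly_mapping_sum_single:
  "p = (\<Sum>t\<in>Poly_Mapping.keys p. Poly_Mapping.single t (Poly_Mapping.lookup p t))"
proof (rule poly_mapping_eqI)
  fix k
  show "Poly_Mapping.lookup p k =
    Poly_Mapping.lookup (\<Sum>t\<in>Poly_Mapping.keys p. Poly_Mapping.single t (Poly_Mapping.lookup p t)) k"
    by (simp add: lookup_sum lookup_single when_def in_keys_iff sum.delta)
qed

text \<open>Indices outside the support contribute factors with exponent 0. This allows products
  belonging to different monomials to run over a common index set.\<close>

lemma monom_value_superset:
  assumes "finite A" "Poly_Mapping.keys t \<subseteq> A"
  shows "monom_value \<sigma> t = (\<Prod>i\<in>A. \<sigma> i ^ Poly_Mapping.lookup t i)"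
  using assms by (intro prod.mono_neutral_left) (auto simp: in_keys_iff)

lemma monom_value_add:
  "monom_value \<sigma> (s + t) = monom_value \<sigma> s * monom_value \<sigma> t"
proof -
  let ?A = "Poly_Mapping.keys s \<union> Poly_Mapping.keys t"
  have "Poly_Mapping.keys (s + t) \<subseteq> ?A" by (rule keys_add)
  then have "monom_value \<sigma> (s + t) = (\<Prod>i\<in>?A. \<sigma> i ^ Poly_Mapping.lookup (s + t) i)"
    by (intro monom_value_superset) simp_all
  moreover have "monom_value \<sigma> s = (\<Prod>i\<in>?A. \<sigma> i ^ Poly_Mapping.lookup s i)"
    and "monom_value \<sigma> t = (\<Prod>i\<in>?A. \<sigma> i ^ Poly_Mapping.lookup t i)"
    by (intro monom_value_superset; simp)+
  ultimately show ?thesis by (simp only: lookup_add power_add prod.distrib)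
qed

lemma Const_add: "Const (a + b) = Const a + Const b"
  by (simp add: Const_def single_add)

lemma Const_mult: "Const (a * b) = Const a * (Const b :: 'a::comm_ring_1 mpol)"
  by (simp add: Const_def mult_single)

lemma Const_0 [simp]: "Const 0 = 0"
  by (simp add: Const_def)

lemma Const_1 [simp]: "Const 1 = 1"
  by (simp add: Const_def)

lemma Const_power: "Const (a ^ k) = (Const a :: 'a::comm_ring_1 mpol) ^ k"
  by (induction k) (simp_all add: Const_mult)

lemma Const_sum: "Const (\<Sum>x\<in>X. f x) = (\<Sum>x\<in>X. Const (f x))"
  by (induction X rule: infinite_finite_induct) (simp_all add: Const_add)

lemma Const_eq_0_iff: "Const c = 0 \<longleftrightarrow> c = 0"
  by (metis Const_0 Const_def lookup_single_eq lookup_zero)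

lemma lookup_Const_mult:
  "Poly_Mapping.lookup (Const c * p) t = c * Poly_Mapping.lookup (p :: 'a::comm_ring_1 mpol) t"
proof -
  have "Const c * p = Poly_Mapping.map ((*) c) p"
    by (simp add: mult_map_scale_conv_mult Const_def)
  then show ?thesis by (simp add: Poly_Mapping.map.rep_eq when_def)
qed

lemma Const_mult_single: "Const c * Poly_Mapping.single t (a::'a::comm_ring_1) = Poly_Mapping.single t (c * a)"
  by (simp add: Const_def mult_single)

lemma subst_vars_superset:
  assumes "finite A" "Poly_Mapping.keys p \<subseteq> A"
  shows "subst_vars \<sigma> p = (\<Sum>t\<in>A. Const (Poly_Mapping.lookup p t) * monom_value \<sigma> t)"
  unfolding subst_vars_def using assms
  by (intro sum.mono_neutral_left) (auto simp: in_keys_iff)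

lemma subst_vars_add: "subst_vars \<sigma> (p + q) = subst_vars \<sigma> p + subst_vars \<sigma> q"
proof -
  let ?A = "Poly_Mapping.keys p \<union> Poly_Mapping.keys q"
  have "Poly_Mapping.keys (p + q) \<subseteq> ?A" by (rule keys_add)
  then show ?thesis
    by (simp add: subst_vars_superset[of ?A] lookup_add Const_add distrib_right sum.distrib)
qed

lemma subst_vars_0 [simp]: "subst_vars \<sigma> 0 = 0"
  by (simp add: subst_vars_def)

lemma subst_vars_sum: "subst_vars \<sigma> (\<Sum>x\<in>X. f x) = (\<Sum>x\<in>X. subst_vars \<sigma> (f x))"
  by (induction X rule: infinite_finite_induct) (simp_all add: subst_vars_add)

lemma subst_vars_single: "subst_vars \<sigma> (Poly_Mapping.single t c) = Const c * monom_value \<sigma> t"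
  by (cases "c = 0") (simp_all add: subst_vars_def)

lemma subst_vars_mult: "subst_vars \<sigma> (p * q) = subst_vars \<sigma> p * subst_vars \<sigma> q"
proof -
  let ?K = Poly_Mapping.keys and ?l = Poly_Mapping.lookup and ?s = Poly_Mapping.single
  have "p * q = (\<Sum>s\<in>?K p. ?s s (?l p s)) * (\<Sum>t\<in>?K q. ?s t (?l q t))"
    using poly_mapping_sum_single[of p] poly_mapping_sum_single[of q] by simp
  also have "\<dots> = (\<Sum>s\<in>?K p. \<Sum>t\<in>?K q. ?s (s + t) (?l p s * ?l q t))"
    by (simp add: sum_product mult_single)
  finally have "subst_vars \<sigma> (p * q) =
      (\<Sum>s\<in>?K p. \<Sum>t\<in>?K q. (Const (?l p s) * monom_value \<sigma> s) * (Const (?l q t) * monom_value \<sigma> t))"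
    by (simp only: subst_vars_sum subst_vars_single monom_value_add Const_mult mult_ac)
  also have "\<dots> = subst_vars \<sigma> p * subst_vars \<sigma> q"
    by (simp add: subst_vars_def sum_product)
  finally show ?thesis .
qed

lemma subst_vars_Const [simp]: "subst_vars \<sigma> (Const c) = Const c"
  by (simp add: Const_def subst_vars_single)

lemma subst_vars_1 [simp]: "subst_vars \<sigma> 1 = 1"
  using subst_vars_Const[of \<sigma> 1] by simp

lemma subst_vars_Var [simp]: "subst_vars \<sigma> (Var i) = \<sigma> i"
  by (simp add: Var_def subst_vars_single)

lemma subst_vars_power: "subst_vars \<sigma> (p ^ k) = subst_vars \<sigma> p ^ k"
  by (induction k) (simp_all add: subst_vars_mult)

lemma subst_vars_prod: "subst_vars \<sigma> (\<Prod>x\<in>X. f x) = (\<Prod>x\<in>X. subst_vars \<sigma> (f x))"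
  by (induction X rule: infinite_finite_induct) (simp_all add: subst_vars_mult)

text \<open>Both substitutions are algebra endomorphisms, so only the images of the variables have
  to be compared. This is the source of the action law \<open>A_comp\<close>.\<close>

lemma subst_vars_subst_vars:
  "subst_vars \<sigma> (subst_vars \<tau> p) = subst_vars (\<lambda>i. subst_vars \<sigma> (\<tau> i)) p"
  unfolding subst_vars_def[of \<tau>] subst_vars_def[of "\<lambda>i. subst_vars \<sigma> (\<tau> i)"]
  by (simp add: subst_vars_sum subst_vars_mult subst_vars_prod subst_vars_power)

lemma Var_power: "(Var i :: 'a::comm_ring_1 mpol) ^ k = Poly_Mapping.single (Poly_Mapping.single i k) 1"
  by (induction k) (simp_all add: Var_def mult_single single_add[symmetric])

lemma prod_single_one:
  "(\<Prod>i\<in>A. Poly_Mapping.single (f i) (1::'a::comm_ring_1)) =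
     Poly_Mapping.single (\<Sum>i\<in>A. f i :: nat \<Rightarrow>\<^sub>0 nat) 1"
  by (induction A rule: infinite_finite_induct) (simp_all add: mult_single)

text \<open>Identifies the formal product over the support with the monomial itself, so that
  substituting the variables for themselves is the identity.\<close>

lemma monom_value_Var: "monom_value Var t = Poly_Mapping.single t 1"
  using poly_mapping_sum_single[of t] by (simp add: Var_power prod_single_one)

lemma subst_vars_id: "subst_vars Var p = p"
  using poly_mapping_sum_single[of p]
  by (simp add: subst_vars_def monom_value_Var Const_mult_single)

lemma subst_vars_cong:
  assumes "\<And>t i. t \<in> Poly_Mapping.keys p \<Longrightarrow> i \<in> Poly_Mapping.keys t \<Longrightarrow> \<sigma> i = \<tau> i"
  shows "subst_vars \<sigma> p = subst_vars \<tau> p"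
  unfolding subst_vars_def using assms by (intro sum.cong prod.cong arg_cong2[where f = "(*)"]) auto

section \<open>The grading by degree and its behaviour under linear substitutions\<close>

lemma homogeneous_polys_0 [simp]: "0 \<in> homogeneous_polys n m"
  by (simp add: homogeneous_polys_def)

lemma homogeneous_polys_add:
  "p \<in> homogeneous_polys n m \<Longrightarrow> q \<in> homogeneous_polys n m \<Longrightarrow> p + q \<in> homogeneous_polys n m"
  using keys_add[of p q] unfolding homogeneous_polys_def by blast

lemma homogeneous_polys_sum:
  "(\<And>x. x \<in> X \<Longrightarrow> f x \<in> homogeneous_polys n m) \<Longrightarrow> (\<Sum>x\<in>X. f x) \<in> homogeneous_polys n m"
  by (induction X rule: infinite_finite_induct) (auto intro: homogeneous_polys_add)

lemma homogeneous_polys_mult: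
  assumes "p \<in> homogeneous_polys n a" "q \<in> homogeneous_polys n b"
  shows "p * q \<in> homogeneous_polys n (a + b)"
proof -
  have "Poly_Mapping.keys t \<subseteq> {..<n} \<and> (\<Sum>i<n. Poly_Mapping.lookup t i) = a + b"
    if t: "t \<in> Poly_Mapping.keys (p * q)" for t
  proof -
    obtain r s where rs: "t = r + s" "r \<in> Poly_Mapping.keys p" "s \<in> Poly_Mapping.keys q"
      using t keys_mult[of p q] by blast
    then have "Poly_Mapping.keys r \<subseteq> {..<n}" "Poly_Mapping.keys s \<subseteq> {..<n}"
      and "(\<Sum>i<n. Poly_Mapping.lookup r i) = a" "(\<Sum>i<n. Poly_Mapping.lookup s i) = b"
      using assms by (auto simp: homogeneous_polys_def)
    then show ?thesis
      using keys_add[of r s] unfolding rs(1) by (auto simp: lookup_add sum.distrib)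
  qed
  then show ?thesis by (simp add: homogeneous_polys_def)
qed

lemma Const_homogeneous: "Const c \<in> homogeneous_polys n 0"
  by (simp add: homogeneous_polys_def Const_def)

lemma one_homogeneous: "(1 :: 'a::comm_ring_1 mpol) \<in> homogeneous_polys n 0"
  using Const_homogeneous[of "1::'a" n] by simp

lemma Const_mult_homogeneous:
  "p \<in> homogeneous_polys n m \<Longrightarrow> Const c * p \<in> homogeneous_polys n m"
  using homogeneous_polys_mult[OF Const_homogeneous] by fastforce

lemma uminus_homogeneous:
  "(p :: 'a::comm_ring_1 mpol) \<in> homogeneous_polys n m \<Longrightarrow> - p \<in> homogeneous_polys n m"
  by (simp add: homogeneous_polys_def)

lemma homogeneous_polys_power:
  "(p :: 'a::comm_ring_1 mpol) \<in> homogeneous_polys n a \<Longrightarrow> p ^ k \<in> homogeneous_polys n (k * a)"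
  by (induction k) (auto intro: homogeneous_polys_mult one_homogeneous)

lemma homogeneous_polys_prod:
  fixes f :: "'b \<Rightarrow> 'a::comm_ring_1 mpol"
  shows "(\<And>x. x \<in> X \<Longrightarrow> f x \<in> homogeneous_polys n (d x)) \<Longrightarrow>
    (\<Prod>x\<in>X. f x) \<in> homogeneous_polys n (\<Sum>x\<in>X. d x)"
  by (induction X rule: infinite_finite_induct)
    (auto intro: homogeneous_polys_mult one_homogeneous)

lemma Var_homogeneous: "i < n \<Longrightarrow> (Var i :: 'a::comm_ring_1 mpol) \<in> homogeneous_polys n 1"
  by (simp add: homogeneous_polys_def Var_def lookup_single when_def)

text \<open>A monomial of degree \<open>m\<close> turns into a product of \<open>m\<close> linear
  forms, counted with multiplicity.\<close>

lemma subst_vars_homogeneous: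
  assumes "p \<in> homogeneous_polys n m" and \<sigma>: "\<And>i. i < n \<Longrightarrow> \<sigma> i \<in> homogeneous_polys n 1"
  shows "subst_vars \<sigma> p \<in> homogeneous_polys n m"
  unfolding subst_vars_def
proof (intro homogeneous_polys_sum Const_mult_homogeneous)
  fix t assume "t \<in> Poly_Mapping.keys p"
  then have t: "Poly_Mapping.keys t \<subseteq> {..<n}" "(\<Sum>i<n. Poly_Mapping.lookup t i) = m"
    using assms(1) by (auto simp: homogeneous_polys_def)
  have "(\<Prod>i<n. \<sigma> i ^ Poly_Mapping.lookup t i) \<in>
      homogeneous_polys n (\<Sum>i<n. Poly_Mapping.lookup t i * 1)"
    by (intro homogeneous_polys_prod homogeneous_polys_power \<sigma>) simp
  then show "monom_value \<sigma> t \<in> homogeneous_polys n m"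
    using t by (simp add: monom_value_superset[of "{..<n}"])
qed

lemma linear_form_homogeneous: "linear_form n v \<in> homogeneous_polys n 1"
  unfolding linear_form_def by (intro homogeneous_polys_sum Const_mult_homogeneous Var_homogeneous) simp

lemma single_one_inj: "Poly_Mapping.single i (1::nat) = Poly_Mapping.single j 1 \<longleftrightarrow> i = j"
  by (metis keys_single singleton_inject zero_neq_one)

lemma linear_form_unit: "i < n \<Longrightarrow> linear_form n (unit_vec n i) = (Var i :: 'a::field mpol)"
proof -
  assume "i < n"
  have "linear_form n (unit_vec n i) = (\<Sum>j<n. if j = i then Var i else (0 :: 'a mpol))"
    unfolding linear_form_def by (intro sum.cong refl) (auto simp: unit_vec_def)
  then show ?thesis using \<open>i < n\<close> by simp
qed

text \<open>The degree-two monomial with indices \<open>b\<close> and \<open>c\<close> can arise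
  only if \<open>a\<close> is one of them, and the other one then selects the entry of
  \<open>v\<close>. Such coefficients later read off the matrix of a linear map.\<close>

lemma lookup_Var_mult_linear_form:
  assumes "a < n" "b < n" "c < n"
  shows "Poly_Mapping.lookup (Var a * linear_form n v)
      (Poly_Mapping.single b 1 + Poly_Mapping.single c 1) =
    (if a = b then v $ c else if a = c then v $ b else 0)"
proof -
  let ?e = "\<lambda>i. Poly_Mapping.single i (1::nat)"
  have inj: "?e a + ?e j = ?e b + ?e c \<longleftrightarrow> (a = b \<and> j = c) \<or> (a = c \<and> j = b)" for j
  proof
    assume eq: "?e a + ?e j = ?e b + ?e c"
    have "Poly_Mapping.lookup (?e a + ?e j) a \<noteq> 0"
      by (simp add: lookup_add)
    then have "a = b \<or> a = c"
      unfolding eq by (simp add: lookup_add lookup_single when_def split: if_splits)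
    then show "(a = b \<and> j = c) \<or> (a = c \<and> j = b)"
      using eq by (metis add.commute add_left_cancel single_one_inj)
  qed (auto simp: add.commute)
  have "Poly_Mapping.lookup (Var a * linear_form n v) (?e b + ?e c) =
      (\<Sum>j<n. v $ j * (if ?e a + ?e j = ?e b + ?e c then 1 else 0))"
    unfolding linear_form_def sum_distrib_left lookup_sum
    by (intro sum.cong refl, subst mult.left_commute, subst lookup_Const_mult)
      (simp add: Var_def mult_single lookup_single when_def)
  \<comment> \<open>At most one \<open>j\<close> matches, namely the partner of \<open>a\<close>;
    the sum is put into the form of a delta sum.\<close>
  also have "\<dots> = (\<Sum>j<n. if j = (if a = b then c else b) then
      (if a = b then v $ c else if a = c then v $ b else 0) else 0)"
    unfolding inj by (intro sum.cong refl) auto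
  also have "\<dots> = (if a = b then v $ c else if a = c then v $ b else 0)"
    using assms by (simp add: sum.delta)
  finally show ?thesis .
qed

section \<open>Linear maps acting on linear forms\<close>

text \<open>Linearity is required on \<open>carrier_vec n\<close> only, since the actions of module
  records are controlled nowhere else.\<close>

locale linear_endo =
  fixes n :: nat and T :: "'a::field vec \<Rightarrow> 'a vec"
  assumes closed: "v \<in> carrier_vec n \<Longrightarrow> T v \<in> carrier_vec n"
    and add: "v \<in> carrier_vec n \<Longrightarrow> w \<in> carrier_vec n \<Longrightarrow> T (v + w) = T v + T w"
    and smult: "v \<in> carrier_vec n \<Longrightarrow> T (c \<cdot>\<^sub>v v) = c \<cdot>\<^sub>v T v"
begin

text \<open>Expansion of \<open>v\<close> in the unit vectors: the numbers
  \<open>T (unit_vec n j) $ i\<close> are the matrix entries of \<open>T\<close>.\<close>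

lemma index:
  assumes "v \<in> carrier_vec n" "i < n"
  shows "T v $ i = (\<Sum>j<n. v $ j * T (unit_vec n j) $ i)"
proof -
  \<comment> \<open>Generalised to vectors supported on the first \<open>k\<close> coordinates, so
    that induction can split off one coordinate at a time.\<close>
  have "T v $ i = (\<Sum>j<k. v $ j * T (unit_vec n j) $ i)"
    if "k \<le> n" "v \<in> carrier_vec n" "\<And>j. k \<le> j \<Longrightarrow> j < n \<Longrightarrow> v $ j = 0" for k v
    using that
  proof (induction k arbitrary: v)
    case 0
    \<comment> \<open>The zero vector is written as a multiple of itself, so that homogeneity of
      \<open>T\<close> gives \<open>T v = 0\<close>.\<close>
    then have "v = 0 \<cdot>\<^sub>v v" by (intro eq_vecI) auto
    then have "T v = 0 \<cdot>\<^sub>v T v" using smult[of v 0] 0 by simp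
    then show ?case using closed[of v] 0 assms(2)
      by (metis carrier_vecD index_smult_vec(1) lessThan_0 mult_zero_left sum.empty)
  next
    case (Suc k)
    let ?e = "unit_vec n k :: 'a vec"
    define w where "w = v + (- v $ k) \<cdot>\<^sub>v ?e"
    have w: "w \<in> carrier_vec n" using Suc.prems by (simp add: w_def)
    have w_index: "w $ j = (if j = k then 0 else v $ j)" if "j < n" for j
      using that Suc.prems by (simp add: w_def)
    have "v = w + v $ k \<cdot>\<^sub>v ?e"
      using Suc.prems by (intro eq_vecI) (auto simp: w_def)
    then have "T v = T w + v $ k \<cdot>\<^sub>v T ?e"
      using add[OF w, of "v $ k \<cdot>\<^sub>v ?e"] smult[of ?e] by simp
    then have "T v $ i = T w $ i + v $ k * T ?e $ i"
      using closed[OF w] closed[of ?e] assms(2) by simp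
    also have "T w $ i = (\<Sum>j<k. w $ j * T (unit_vec n j) $ i)"
      using Suc.prems w w_index by (intro Suc.IH) auto
    also have "\<dots> = (\<Sum>j<k. v $ j * T (unit_vec n j) $ i)"
      using Suc.prems w_index by (intro sum.cong) auto
    finally show ?case by simp
  qed
  from this[of n v] assms(1) show ?thesis by simp
qed

text \<open>On the degree-one part the substitution is \<open>T\<close> itself; exchanging the two
  sums is the matrix-vector product.\<close>

lemma subst_linear_form:
  assumes "v \<in> carrier_vec n"
  shows "subst_vars (\<lambda>i. linear_form n (T (unit_vec n i))) (linear_form n v) = linear_form n (T v)"
proof -
  let ?T = "\<lambda>i j. T (unit_vec n i) $ j"
  have "subst_vars (\<lambda>i. linear_form n (T (unit_vec n i))) (linear_form n v) =
      (\<Sum>i<n. \<Sum>j<n. Const (v $ i) * (Const (?T i j) * Var j))"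
    by (simp add: linear_form_def[of n v] subst_vars_sum subst_vars_mult)
      (simp add: linear_form_def sum_distrib_left)
  also have "\<dots> = (\<Sum>j<n. Const (\<Sum>i<n. v $ i * ?T i j) * Var j)"
    by (subst sum.swap) (simp add: Const_sum Const_mult sum_distrib_right mult.assoc)
  also have "\<dots> = linear_form n (T v)"
    unfolding linear_form_def by (simp add: index[OF assms])
  finally show ?thesis .
qed

text \<open>Comparing the coefficients of \<open>Var i * Var i\<close> and \<open>Var i * Var j\<close> in
  \<open>Var i * T (Var j) = Var j * T (Var i)\<close> shows that \<open>T\<close> is diagonal and then scalar.\<close>

lemma scalar_if_proportional:
  assumes "0 < n"
    and proportional: "\<And>v w. v \<in> carrier_vec n \<Longrightarrow> w \<in> carrier_vec n \<Longrightarrow>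
      linear_form n v * linear_form n (T w) = linear_form n w * linear_form n (T v)"
  shows "\<exists>c. \<forall>v\<in>carrier_vec n. T v = c \<cdot>\<^sub>v v"
proof -
  let ?T = "\<lambda>i j. T (unit_vec n i) $ j"
  have eq: "Var i * linear_form n (T (unit_vec n j)) = Var j * linear_form n (T (unit_vec n i))"
    if "i < n" "j < n" for i j
    using proportional[of "unit_vec n i" "unit_vec n j"] that by (simp add: linear_form_unit)
  have offdiag: "?T i j = 0" if "i < n" "j < n" "i \<noteq> j" for i j
    using arg_cong[OF eq[of i j], of "\<lambda>p. Poly_Mapping.lookup p (Poly_Mapping.single j 1 + Poly_Mapping.single j 1)"] that
    by (simp only: lookup_Var_mult_linear_form) simp
  have diag: "?T i i = ?T j j" if "i < n" "j < n" for i j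
    using arg_cong[OF eq[of i j], of "\<lambda>p. Poly_Mapping.lookup p (Poly_Mapping.single i 1 + Poly_Mapping.single j 1)"] that
    by (cases "i = j") (simp_all only: lookup_Var_mult_linear_form, simp_all)
  \<comment> \<open>The scalar is the common diagonal entry, read off at index 0, which exists
    because \<open>0 < n\<close>.\<close>
  have "T v = ?T 0 0 \<cdot>\<^sub>v v" if v: "v \<in> carrier_vec n" for v
  proof (rule eq_vecI)
    fix i assume "i < dim_vec (?T 0 0 \<cdot>\<^sub>v v)"
    then have i: "i < n" using v by simp
    have "T v $ i = (\<Sum>j<n. if j = i then v $ i * ?T 0 0 else 0)"
      unfolding index[OF v i]
      using offdiag[of _ i] diag[of i 0] i \<open>0 < n\<close> by (intro sum.cong) auto
    then show "T v $ i = (?T 0 0 \<cdot>\<^sub>v v) $ i" using i v by simp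
  qed (use closed[OF v] v in simp)
  then show ?thesis by blast
qed

end

section \<open>Modules over a group algebra\<close>

text \<open>Bridge from \<open>finsum\<close> in a module record to an ordinary sum. The value at
  zero settles empty and infinite index sets.\<close>

lemma (in abelian_monoid) additive_finsum:
  assumes add: "\<And>u v. u \<in> carrier G \<Longrightarrow> v \<in> carrier G \<Longrightarrow> f (u \<oplus> v) = f u + f v"
    and zero: "f \<zero> = 0" and x: "x \<in> X \<rightarrow> carrier G"
  shows "f (finsum G x X) = (\<Sum>i\<in>X. f (x i) :: 'd::comm_monoid_add)"
  using x
proof (induction X rule: infinite_finite_induct)
  case (insert i X)
  then have "f (x i \<oplus> finsum G x X) = f (x i) + f (finsum G x X)"
    by (intro add finsum_closed) auto
  with insert show ?case by (simp add: Pi_iff)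
qed (simp_all add: zero)

text \<open>The upper bound for Zorn's lemma: any two elements of the union already lie in one
  member of the chain. Below, \<open>P\<close> says that a fixed vector is avoided.\<close>

lemma submodule_chain_Union:
  assumes "module R M" "C \<noteq> {}" "subset.chain {U. submodule R U M \<and> P U} C"
  shows "submodule R (\<Union>C) M"
proof -
  have C: "submodule R U M" if "U \<in> C" for U
    using assms(3) that by (auto simp: subset_chain_def)
  have "v \<oplus>\<^bsub>M\<^esub> w \<in> \<Union>C" if vw: "v \<in> \<Union>C" "w \<in> \<Union>C" for v w
  proof -
    obtain X Y where XY: "X \<in> C" "Y \<in> C" "v \<in> X" "w \<in> Y" using vw by blast
    then have "X \<subseteq> Y \<or> Y \<subseteq> X" using assms(3) by (auto simp: subset_chain_def)
    then show ?thesis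
      using XY submodule.m_closed[OF C] by blast
  qed
  moreover have "\<zero>\<^bsub>M\<^esub> \<in> \<Union>C"
    using assms(2) submodule.zero_closed[OF C] by blast
  moreover have "\<Union>C \<subseteq> carrier M"
    using submodule.subset[OF C] by blast
  moreover have "c \<odot>\<^bsub>M\<^esub> v \<in> \<Union>C" if "c \<in> carrier R" "v \<in> \<Union>C" for c v
    using that submodule.smult_closed[OF C] by blast
  ultimately show ?thesis
    using assms(1) by (intro submodule.intro) auto
qed

text \<open>By Zorn there is a maximal submodule \<open>U\<close> avoiding \<open>w\<close>. It is a
  complement of the line through \<open>w\<close>, and \<open>l\<close> is the coordinate along
  \<open>w\<close>.\<close>

lemma exists_linear_functional:
  fixes V :: "('a::field, 'v, 'm) module_scheme"
  assumes V: "vectorspace class_ring V" and w: "w \<in> carrier V" "w \<noteq> \<zero>\<^bsub>V\<^esub>"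
  shows "\<exists>l :: 'v \<Rightarrow> 'a. l w = 1 \<and>
    (\<forall>u\<in>carrier V. \<forall>v\<in>carrier V. l (u \<oplus>\<^bsub>V\<^esub> v) = l u + l v) \<and>
    (\<forall>c. \<forall>v\<in>carrier V. l (c \<odot>\<^bsub>V\<^esub> v) = c * l v)"
proof -
  interpret vectorspace class_ring V by (rule V)
  have smult: "c \<odot>\<^bsub>V\<^esub> v \<in> carrier V" if "v \<in> carrier V" for c v
    using that smult_closed[of c v] by simp
  have l_distr: "(a + b) \<odot>\<^bsub>V\<^esub> v = a \<odot>\<^bsub>V\<^esub> v \<oplus>\<^bsub>V\<^esub> b \<odot>\<^bsub>V\<^esub> v" if "v \<in> carrier V" for a b v
    using that smult_l_distr[of a b v] by simp
  have r_distr: "a \<odot>\<^bsub>V\<^esub> (u \<oplus>\<^bsub>V\<^esub> v) = a \<odot>\<^bsub>V\<^esub> u \<oplus>\<^bsub>V\<^esub> a \<odot>\<^bsub>V\<^esub> v" if "u \<in> carrier V" "v \<in> carrier V" for a u v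
    using that smult_r_distr[of a u v] by simp
  have assoc: "(a * b) \<odot>\<^bsub>V\<^esub> v = a \<odot>\<^bsub>V\<^esub> (b \<odot>\<^bsub>V\<^esub> v)" if "v \<in> carrier V" for a b v
    using that smult_assoc1[of a b v] by simp
  have one: "(1::'a) \<odot>\<^bsub>V\<^esub> v = v" and zero: "(0::'a) \<odot>\<^bsub>V\<^esub> v = \<zero>\<^bsub>V\<^esub>" if "v \<in> carrier V" for v
    using that smult_one[of v] lmult_0[of v] by simp_all
  let ?A = "{U. submodule class_ring U V \<and> w \<notin> U}"
  have "submodule class_ring {\<zero>\<^bsub>V\<^esub>} V"
    using is_module module_axioms by (intro submodule.intro) auto
  then have "{\<zero>\<^bsub>V\<^esub>} \<in> ?A" using w by simp
  then have "\<exists>U\<in>?A. \<forall>X\<in>?A. U \<subseteq> X \<longrightarrow> X = U"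
  proof (intro subset_Zorn_nonempty)
    fix C assume C: "C \<noteq> {}" "subset.chain ?A C"
    then show "\<Union>C \<in> ?A"
      using submodule_chain_Union[OF module_axioms C] by (auto simp: subset_chain_def)
  qed blast
  then obtain U where U: "submodule class_ring U V" "w \<notin> U"
    and maximal: "\<And>X. submodule class_ring X V \<Longrightarrow> w \<notin> X \<Longrightarrow> U \<subseteq> X \<Longrightarrow> X = U"
    by blast
  interpret U: submodule class_ring U V by (rule U)
  have U_carrier: "u \<in> carrier V" if "u \<in> U" for u using that U.subset by blast
  have U_smult: "c \<odot>\<^bsub>V\<^esub> u \<in> U" if "u \<in> U" for c u using that U.smult_closed[of c u] by simp
  \<comment> \<open>Adjoin \<open>v\<close> to \<open>U\<close>. By maximality either
    \<open>v\<close> was in \<open>U\<close> already, or the larger space contains \<open>w\<close>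
    and the resulting relation can be solved for \<open>v\<close>.\<close>
  have ex: "\<exists>c. \<exists>u\<in>U. v = u \<oplus>\<^bsub>V\<^esub> c \<odot>\<^bsub>V\<^esub> w" if v: "v \<in> carrier V" for v
  proof -
    let ?X = "{u \<oplus>\<^bsub>V\<^esub> c \<odot>\<^bsub>V\<^esub> v | u c. u \<in> U}"
    have "submodule class_ring ?X V"
    proof (intro submodule.intro module_axioms)
      show "?X \<subseteq> carrier V" using v U_carrier smult by blast
      show "\<zero>\<^bsub>V\<^esub> \<in> ?X"
      proof -
        have "\<zero>\<^bsub>V\<^esub> = \<zero>\<^bsub>V\<^esub> \<oplus>\<^bsub>V\<^esub> 0 \<odot>\<^bsub>V\<^esub> v" using v by (simp add: zero)
        then show ?thesis using U.zero_closed by blast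
      qed
      show "x \<oplus>\<^bsub>V\<^esub> y \<in> ?X" if xy: "x \<in> ?X" "y \<in> ?X" for x y
      proof -
        obtain u c u' c' where "u \<in> U" "u' \<in> U" "x = u \<oplus>\<^bsub>V\<^esub> c \<odot>\<^bsub>V\<^esub> v" "y = u' \<oplus>\<^bsub>V\<^esub> c' \<odot>\<^bsub>V\<^esub> v"
          using xy by blast
        then have "x \<oplus>\<^bsub>V\<^esub> y = (u \<oplus>\<^bsub>V\<^esub> u') \<oplus>\<^bsub>V\<^esub> (c + c') \<odot>\<^bsub>V\<^esub> v" "u \<oplus>\<^bsub>V\<^esub> u' \<in> U"
          using v U_carrier smult by (simp_all add: l_distr a_ac)
        then show ?thesis by blast
      qed
      show "a \<odot>\<^bsub>V\<^esub> x \<in> ?X" if x: "x \<in> ?X" for a x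
      proof -
        obtain u c where "u \<in> U" "x = u \<oplus>\<^bsub>V\<^esub> c \<odot>\<^bsub>V\<^esub> v" using x by blast
        then have "a \<odot>\<^bsub>V\<^esub> x = a \<odot>\<^bsub>V\<^esub> u \<oplus>\<^bsub>V\<^esub> (a * c) \<odot>\<^bsub>V\<^esub> v" "a \<odot>\<^bsub>V\<^esub> u \<in> U"
          using v U_carrier smult U_smult by (simp_all add: r_distr assoc)
        then show ?thesis by blast
      qed
    qed
    moreover have "U \<subseteq> ?X"
    proof
      fix u assume "u \<in> U"
      then have "u = u \<oplus>\<^bsub>V\<^esub> 0 \<odot>\<^bsub>V\<^esub> v" using v U_carrier by (simp add: zero)
      then show "u \<in> ?X" using \<open>u \<in> U\<close> by blast
    qed
    moreover have "v \<in> ?X"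
    proof -
      have "v = \<zero>\<^bsub>V\<^esub> \<oplus>\<^bsub>V\<^esub> 1 \<odot>\<^bsub>V\<^esub> v" using v by (simp add: one)
      then show ?thesis using U.zero_closed by blast
    qed
    ultimately have "v \<in> U" if "w \<notin> ?X"
      using maximal[of ?X] that by (simp only: simp_thms)
    then have "w \<in> ?X \<or> v \<in> U" by blast
    then show ?thesis
    proof
      assume "v \<in> U"
      moreover have "v = v \<oplus>\<^bsub>V\<^esub> 0 \<odot>\<^bsub>V\<^esub> w" using v w by (simp add: zero)
      ultimately show ?thesis by blast
    next
      assume "w \<in> ?X"
      then obtain u c where u: "u \<in> U" "w = u \<oplus>\<^bsub>V\<^esub> c \<odot>\<^bsub>V\<^esub> v" by blast
      \<comment> \<open>Otherwise \<open>w\<close> would equal \<open>u\<close> and lie in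
        \<open>U\<close>.\<close>
      have "c \<noteq> 0" using u U v U_carrier by (auto simp: zero)
      define d where "d = inverse c"
      have "d \<odot>\<^bsub>V\<^esub> w = d \<odot>\<^bsub>V\<^esub> u \<oplus>\<^bsub>V\<^esub> (d * c) \<odot>\<^bsub>V\<^esub> v"
        using u v U_carrier smult by (simp add: r_distr assoc)
      also have "(d * c) \<odot>\<^bsub>V\<^esub> v = v"
        using \<open>c \<noteq> 0\<close> v by (simp add: d_def one)
      finally have "(- d) \<odot>\<^bsub>V\<^esub> u \<oplus>\<^bsub>V\<^esub> d \<odot>\<^bsub>V\<^esub> w = ((- d) \<odot>\<^bsub>V\<^esub> u \<oplus>\<^bsub>V\<^esub> d \<odot>\<^bsub>V\<^esub> u) \<oplus>\<^bsub>V\<^esub> v"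
        using u v U_carrier smult by (simp add: a_assoc)
      also have "(- d) \<odot>\<^bsub>V\<^esub> u \<oplus>\<^bsub>V\<^esub> d \<odot>\<^bsub>V\<^esub> u = \<zero>\<^bsub>V\<^esub>"
        using l_distr[of u "- d" d] u U_carrier zero[of u] by simp
      finally have "v = (- d) \<odot>\<^bsub>V\<^esub> u \<oplus>\<^bsub>V\<^esub> d \<odot>\<^bsub>V\<^esub> w" using v by simp
      then show ?thesis using U_smult[OF u(1)] by blast
    qed
  qed
  \<comment> \<open>Two different coordinates would put a nonzero multiple of \<open>w\<close>,
    hence \<open>w\<close>, into \<open>U\<close>.\<close>
  have unique: "c = d"
    if u: "u \<in> U" "u' \<in> U" and eq: "u \<oplus>\<^bsub>V\<^esub> c \<odot>\<^bsub>V\<^esub> w = u' \<oplus>\<^bsub>V\<^esub> d \<odot>\<^bsub>V\<^esub> w" for u u' c d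
  proof (rule ccontr)
    assume "c \<noteq> d"
    have [simp]: "u \<in> carrier V" "u' \<in> carrier V" using u U_carrier by auto
    have "(c - d) \<odot>\<^bsub>V\<^esub> w = ((- 1) \<odot>\<^bsub>V\<^esub> u \<oplus>\<^bsub>V\<^esub> 1 \<odot>\<^bsub>V\<^esub> u) \<oplus>\<^bsub>V\<^esub> (c \<odot>\<^bsub>V\<^esub> w \<oplus>\<^bsub>V\<^esub> (- d) \<odot>\<^bsub>V\<^esub> w)"
      using l_distr[of u "- 1" 1] l_distr[of w c "- d"] w by (simp add: zero smult)
    also have "\<dots> = (- 1) \<odot>\<^bsub>V\<^esub> u \<oplus>\<^bsub>V\<^esub> ((u \<oplus>\<^bsub>V\<^esub> c \<odot>\<^bsub>V\<^esub> w) \<oplus>\<^bsub>V\<^esub> (- d) \<odot>\<^bsub>V\<^esub> w)"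
      using w by (simp add: one smult a_assoc)
    also have "\<dots> = (- 1) \<odot>\<^bsub>V\<^esub> u \<oplus>\<^bsub>V\<^esub> (u' \<oplus>\<^bsub>V\<^esub> (d \<odot>\<^bsub>V\<^esub> w \<oplus>\<^bsub>V\<^esub> (- d) \<odot>\<^bsub>V\<^esub> w))"
      unfolding eq using w by (simp add: smult a_assoc)
    also have "\<dots> = (- 1) \<odot>\<^bsub>V\<^esub> u \<oplus>\<^bsub>V\<^esub> u'"
      using w by (simp add: l_distr[symmetric] zero)
    finally have "(c - d) \<odot>\<^bsub>V\<^esub> w \<in> U" using u U_smult by simp
    then have "inverse (c - d) \<odot>\<^bsub>V\<^esub> ((c - d) \<odot>\<^bsub>V\<^esub> w) \<in> U" by (rule U_smult)
    moreover have "inverse (c - d) \<odot>\<^bsub>V\<^esub> ((c - d) \<odot>\<^bsub>V\<^esub> w) = w"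
      using \<open>c \<noteq> d\<close> w by (simp add: assoc[symmetric] one)
    ultimately show False using U by simp
  qed
  define l where "l v = (SOME c. \<exists>u\<in>U. v = u \<oplus>\<^bsub>V\<^esub> c \<odot>\<^bsub>V\<^esub> w)" for v
  have l: "\<exists>u\<in>U. v = u \<oplus>\<^bsub>V\<^esub> l v \<odot>\<^bsub>V\<^esub> w" if "v \<in> carrier V" for v
    unfolding l_def by (rule someI_ex) (rule ex[OF that])
  have l_eq: "l v = c" if u: "u \<in> U" "v = u \<oplus>\<^bsub>V\<^esub> c \<odot>\<^bsub>V\<^esub> w" and v: "v \<in> carrier V" for u v c
  proof -
    obtain y where y: "y \<in> U" "v = y \<oplus>\<^bsub>V\<^esub> l v \<odot>\<^bsub>V\<^esub> w" using l[OF v] by blast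
    show ?thesis by (rule unique[OF y(1) u(1) trans[OF y(2)[symmetric] u(2)]])
  qed
  have "l (u \<oplus>\<^bsub>V\<^esub> v) = l u + l v" if uv: "u \<in> carrier V" "v \<in> carrier V" for u v
  proof -
    obtain x y where xy: "x \<in> U" "u = x \<oplus>\<^bsub>V\<^esub> l u \<odot>\<^bsub>V\<^esub> w" "y \<in> U" "v = y \<oplus>\<^bsub>V\<^esub> l v \<odot>\<^bsub>V\<^esub> w"
      using l uv by blast
    have "u \<oplus>\<^bsub>V\<^esub> v = (x \<oplus>\<^bsub>V\<^esub> l u \<odot>\<^bsub>V\<^esub> w) \<oplus>\<^bsub>V\<^esub> (y \<oplus>\<^bsub>V\<^esub> l v \<odot>\<^bsub>V\<^esub> w)"
      by (rule arg_cong2[OF xy(2,4)])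
    also have "\<dots> = (x \<oplus>\<^bsub>V\<^esub> y) \<oplus>\<^bsub>V\<^esub> (l u + l v) \<odot>\<^bsub>V\<^esub> w"
      using xy(1,3) w U_carrier smult by (simp add: l_distr a_ac)
    finally show ?thesis using xy(1,3) uv by (intro l_eq[of "x \<oplus>\<^bsub>V\<^esub> y"] a_closed U.m_closed)
  qed
  moreover have "l (c \<odot>\<^bsub>V\<^esub> v) = c * l v" if v: "v \<in> carrier V" for c v
  proof -
    obtain y where y: "y \<in> U" "v = y \<oplus>\<^bsub>V\<^esub> l v \<odot>\<^bsub>V\<^esub> w"
      using l v by blast
    have "c \<odot>\<^bsub>V\<^esub> v = c \<odot>\<^bsub>V\<^esub> (y \<oplus>\<^bsub>V\<^esub> l v \<odot>\<^bsub>V\<^esub> w)" by (rule arg_cong[OF y(2)])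
    also have "\<dots> = c \<odot>\<^bsub>V\<^esub> y \<oplus>\<^bsub>V\<^esub> (c * l v) \<odot>\<^bsub>V\<^esub> w"
      using y(1) w U_carrier smult by (simp add: r_distr assoc)
    finally show ?thesis using y(1) v by (intro l_eq[of "c \<odot>\<^bsub>V\<^esub> y"] U_smult smult)
  qed
  moreover have "l w = 1"
    using w by (intro l_eq[of "\<zero>\<^bsub>V\<^esub>"]) (auto simp: one)
  ultimately show ?thesis by blast
qed

section \<open>Equivariant maps to and from an irreducible module\<close>

context FG_module
begin

lemma act_closed: "g \<in> carrier G \<Longrightarrow> v \<in> carrier V \<Longrightarrow> act V g v \<in> carrier V"
  using act_linear[of g] by (auto simp: LinearCombinations.module_hom_def)

lemma act_zero:
  assumes "g \<in> carrier G"
  shows "act V g \<zero>\<^bsub>V\<^esub> = \<zero>\<^bsub>V\<^esub>"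
proof -
  interpret mod_hom K V V "act V g"
    by unfold_locales (rule act_linear[OF assms])
  show ?thesis by (rule f0_is_0)
qed

lemma act_add:
  "g \<in> carrier G \<Longrightarrow> u \<in> carrier V \<Longrightarrow> v \<in> carrier V \<Longrightarrow>
    act V g (u \<oplus>\<^bsub>V\<^esub> v) = act V g u \<oplus>\<^bsub>V\<^esub> act V g v"
  using act_linear[of g] by (simp add: LinearCombinations.module_hom_def)

lemma act_smult:
  "g \<in> carrier G \<Longrightarrow> a \<in> carrier K \<Longrightarrow> v \<in> carrier V \<Longrightarrow>
    act V g (a \<odot>\<^bsub>V\<^esub> v) = a \<odot>\<^bsub>V\<^esub> act V g v"
  using act_linear[of g] by (simp add: LinearCombinations.module_hom_def)

lemma act_finsum:
  assumes g: "g \<in> carrier G" and "x \<in> X \<rightarrow> carrier V"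
  shows "act V g (finsum V x X) = finsum V (\<lambda>i. act V g (x i)) X"
proof -
  interpret g: mod_hom K V V "act V g"
    by unfold_locales (rule act_linear[OF g])
  show ?thesis using assms(2)
  proof (induction X rule: infinite_finite_induct)
    case (insert i X)
    then have "(\<lambda>i. act V g (x i)) \<in> X \<rightarrow> carrier V" by auto
    with insert g show ?case by (simp add: Pi_iff)
  qed simp_all
qed

end

context irreducible_FG_module
begin

text \<open>Schur's argument: the kernel is a submodule other than the whole of \<open>V\<close>,
  hence zero, so \<open>V\<close> is isomorphic to the image of \<open>f\<close>.\<close>

lemma iso_to_submoduleI:
  fixes M :: "('a, 'g, 'w, 'n) fg_module_scheme"
  assumes M: "vectorspace K M" and f: "f \<in> LinearCombinations.module_hom K V M"
    and equivariant: "\<And>g v. g \<in> carrier G \<Longrightarrow> v \<in> carrier V \<Longrightarrow> f (act V g v) = act M g (f v)"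
    and nonzero: "v0 \<in> carrier V" "f v0 \<noteq> \<zero>\<^bsub>M\<^esub>"
  shows "iso_to_submodule K G V M"
proof -
  interpret M: vectorspace K M by (rule M)
  interpret f: linear_map K V M f
    by unfold_locales (rule f)
  \<comment> \<open>\<open>M\<close> is only known to be a vector space here, so this is drawn from
    equivariance at the zero of \<open>V\<close>.\<close>
  have "act M g \<zero>\<^bsub>M\<^esub> = \<zero>\<^bsub>M\<^esub>" if "g \<in> carrier G" for g
    using that equivariant[of g "\<zero>\<^bsub>V\<^esub>"] by (simp add: act_zero)
  then have "FG_submodule K G f.ker V"
    unfolding FG_submodule_def
    using f.kerT_is_subspace equivariant act_closed by (simp add: f.ker_def)
  then have "f.ker = {\<zero>\<^bsub>V\<^esub>}"
    using irreducible nonzero by (auto simp: f.ker_def)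
  then have inj: "inj_on f (carrier V)"
    by (simp add: f.Ke0_iff_inj)
  let ?U = "f ` carrier V"
  have "FG_submodule K G ?U M"
    unfolding FG_submodule_def
    using f.imT_is_subspace equivariant[symmetric] act_closed by (auto simp: f.im_def)
  moreover have "FG_iso K G V (sub_FG M ?U)"
    unfolding FG_iso_def
  proof (intro bexI conjI ballI)
    show "bij_betw f (carrier V) (carrier (sub_FG M ?U))"
      using inj by (simp add: bij_betw_def sub_FG_def)
    show "f (act V g v) = act (sub_FG M ?U) g (f v)" if "g \<in> carrier G" "v \<in> carrier V" for g v
      using that equivariant by (simp add: sub_FG_def)
    show "f \<in> LinearCombinations.module_hom K V (sub_FG M ?U)"
      using f by (auto simp: LinearCombinations.module_hom_def sub_FG_def)
  qed
  ultimately show ?thesis by (auto simp: iso_to_submodule_def)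
qed

text \<open>The dual argument: the image is a nonzero submodule, hence all of \<open>V\<close>, and
  the first isomorphism theorem applies.\<close>

lemma iso_to_quotientI:
  fixes M :: "('a, 'g, 'w, 'n) fg_module_scheme"
  assumes M: "vectorspace K M" and f: "f \<in> LinearCombinations.module_hom K M V"
    and act_M: "\<And>g v. g \<in> carrier G \<Longrightarrow> v \<in> carrier M \<Longrightarrow> act M g v \<in> carrier M"
    and equivariant: "\<And>g v. g \<in> carrier G \<Longrightarrow> v \<in> carrier M \<Longrightarrow> f (act M g v) = act V g (f v)"
    and nonzero: "v0 \<in> carrier M" "f v0 \<noteq> \<zero>\<^bsub>V\<^esub>"
  shows "iso_to_quotient K G V M"
proof -
  interpret M: vectorspace K M by (rule M)
  interpret f: linear_map K M V f
    by unfold_locales (rule f)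
  let ?U = "f.ker"
  have U: "FG_submodule K G ?U M"
    unfolding FG_submodule_def
    using f.kerT_is_subspace equivariant act_M act_zero by (auto simp: f.ker_def)
  have "FG_submodule K G f.im V"
    unfolding FG_submodule_def
    using f.imT_is_subspace equivariant[symmetric] act_M by (auto simp: f.im_def)
  then have surj: "f ` carrier M = carrier V"
    using irreducible nonzero by (auto simp: f.im_def)
  \<comment> \<open>The inverse of the map induced by \<open>f\<close>: it sends \<open>v\<close> to
    its fibre, which is a coset of the kernel. In this direction no choice of representatives has to
    be justified.\<close>
  define F where "F v = {x \<in> carrier M. f x = v}" for v
  have F: "?U +>\<^bsub>M\<^esub> x = F (f x)" if x: "x \<in> carrier M" for x
  proof (intro equalityI subsetI)
    fix y assume "y \<in> F (f x)"
    then have y: "y \<in> carrier M" "f y = f x" by (auto simp: F_def)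
    have "y \<ominus>\<^bsub>M\<^esub> x \<in> ?U"
      using x y f.f_minus[OF y(1) x] by (simp add: f.ker_def)
    moreover have "y = (y \<ominus>\<^bsub>M\<^esub> x) \<oplus>\<^bsub>M\<^esub> x"
      using x y by (simp add: M.minus_eq M.add.m_assoc M.l_neg)
    ultimately show "y \<in> ?U +>\<^bsub>M\<^esub> x"
      unfolding a_r_coset_def' by blast
  qed (use x in \<open>auto simp: a_r_coset_def' F_def f.ker_def\<close>)
  have rcosets: "a_rcosets\<^bsub>M\<^esub> ?U = F ` carrier V"
  proof -
    have "a_rcosets\<^bsub>M\<^esub> ?U = (\<lambda>x. ?U +>\<^bsub>M\<^esub> x) ` carrier M"
      unfolding A_RCOSETS_def' by blast
    also have "\<dots> = F ` f ` carrier M"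
      unfolding image_image using F by (rule image_cong[OF refl])
    finally show ?thesis by (simp only: surj)
  qed
  have F_nonempty: "\<exists>x. x \<in> F v" if "v \<in> carrier V" for v
  proof -
    from that obtain x where "x \<in> carrier M" "v = f x"
      unfolding surj[symmetric] by blast
    then show ?thesis by (auto simp: F_def)
  qed
  have "FG_iso K G V (quot_FG M ?U)"
    unfolding FG_iso_def
  proof (intro bexI conjI ballI)
    have "inj_on F (carrier V)"
    proof (rule inj_onI)
      fix v w assume "v \<in> carrier V" "F v = F w"
      then obtain x where "x \<in> F v" "x \<in> F w" using F_nonempty by blast
      then show "v = w" by (simp add: F_def)
    qed
    then show "bij_betw F (carrier V) (carrier (quot_FG M ?U))"
      by (simp add: bij_betw_def quot_FG_def rcosets)
    show "F (act V g v) = act (quot_FG M ?U) g (F v)" if "g \<in> carrier G" "v \<in> carrier V" for g v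
    proof -
      have "?U +>\<^bsub>M\<^esub> act M g x = F (act V g v)" if "x \<in> F v" for x
        using that F[of "act M g x"] act_M equivariant \<open>g \<in> carrier G\<close> by (simp add: F_def)
      \<comment> \<open>All members of the union coincide; nonemptiness of the fibre keeps the union
        from being empty.\<close>
      then have "F (act V g v) = (\<Union>x\<in>F v. ?U +>\<^bsub>M\<^esub> act M g x)"
        using F_nonempty[OF that(2)] by auto
      then show ?thesis using that by (simp add: quot_FG_def rcosets)
    qed
    have "F (c \<odot>\<^bsub>V\<^esub> v) = (\<Union>x\<in>F v. ?U +>\<^bsub>M\<^esub> (c \<odot>\<^bsub>M\<^esub> x))"
      if "c \<in> carrier K" "v \<in> carrier V" for c v
    proof -
      have "?U +>\<^bsub>M\<^esub> (c \<odot>\<^bsub>M\<^esub> x) = F (c \<odot>\<^bsub>V\<^esub> v)" if "x \<in> F v" for x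
        using that F[of "c \<odot>\<^bsub>M\<^esub> x"] \<open>c \<in> carrier K\<close> by (simp add: F_def)
      then show ?thesis using F_nonempty[OF that(2)] by auto
    qed
    moreover have "F (v \<oplus>\<^bsub>V\<^esub> w) = F v <+>\<^bsub>M\<^esub> F w" if vw: "v \<in> carrier V" "w \<in> carrier V" for v w
    proof (intro equalityI subsetI)
      fix y assume "y \<in> F (v \<oplus>\<^bsub>V\<^esub> w)"
      then have y: "y \<in> carrier M" "f y = v \<oplus>\<^bsub>V\<^esub> w" by (auto simp: F_def)
      obtain x where x: "x \<in> carrier M" "f x = w" using F_nonempty[OF vw(2)] by (auto simp: F_def)
      have "y \<ominus>\<^bsub>M\<^esub> x \<in> F v"
        using x y vw f.f_minus[OF y(1) x(1)]
        by (simp add: F_def minus_eq M.add.m_assoc add.m_assoc r_neg)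
      moreover have "y = (y \<ominus>\<^bsub>M\<^esub> x) \<oplus>\<^bsub>M\<^esub> x"
        using x y by (simp add: M.minus_eq M.add.m_assoc M.l_neg)
      ultimately show "y \<in> F v <+>\<^bsub>M\<^esub> F w"
        unfolding set_add_def' using x by (auto simp: F_def)
    qed (auto simp: set_add_def' F_def)
    ultimately show "F \<in> LinearCombinations.module_hom K V (quot_FG M ?U)"
      by (auto simp: LinearCombinations.module_hom_def quot_FG_def rcosets)
  qed
  with U show ?thesis by (auto simp: iso_to_quotient_def)
qed

end

section \<open>The concrete modules: column vectors and symmetric powers\<close>

lemma vec_FG_simps:
  "carrier (vec_FG n \<rho>) = carrier_vec n" "act (vec_FG n \<rho>) = \<rho>"
  "v \<oplus>\<^bsub>vec_FG n \<rho>\<^esub> w = v + w" "c \<odot>\<^bsub>vec_FG n \<rho>\<^esub> v = c \<cdot>\<^sub>v v"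
  by (simp_all add: vec_FG_def module.defs fg_module.defs module_vec_def)

lemma Sym_FG_simps:
  "carrier (Sym_FG n m V) = homogeneous_polys n m" "\<zero>\<^bsub>Sym_FG n m V\<^esub> = 0"
  "p \<oplus>\<^bsub>Sym_FG n m V\<^esub> q = p + q" "c \<odot>\<^bsub>Sym_FG n m V\<^esub> p = Const c * p"
  by (simp_all add: Sym_FG_def)

lemma vectorspace_Sym_FG: "vectorspace class_ring (Sym_FG n m V)"
proof (rule vs_criteria)
  show "\<forall>p\<in>carrier (Sym_FG n m V). \<exists>q\<in>carrier (Sym_FG n m V). p \<oplus>\<^bsub>Sym_FG n m V\<^esub> q = \<zero>\<^bsub>Sym_FG n m V\<^esub>"
    by (auto simp: Sym_FG_simps intro!: bexI[OF _ uminus_homogeneous])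
qed (auto simp: Sym_FG_simps class_field homogeneous_polys_add Const_mult_homogeneous
  Const_mult Const_add distrib_left distrib_right mult.assoc add.assoc add.commute)

section \<open>Dedekind's argument for a faithful representation\<close>

text \<open>A graded form of independence of characters: \<open>H m\<close> plays the part of degree
  \<open>m\<close>, and each \<open>A i\<close> is multiplicative with values in a domain. Only
  \<open>k\<close> has to be non-proportional to the other indices. Each removed index costs one
  degree, whence \<open>card S \<le> m\<close>.\<close>

lemma dedekind_nonvanishing:
  fixes A :: "'i \<Rightarrow> 'p::comm_monoid_mult \<Rightarrow> 'b::idom" and H :: "nat \<Rightarrow> 'p set"
  assumes A_1: "\<And>i. A i 1 = 1" and A_mult: "\<And>i p q. A i (p * q) = A i p * A i q"
    and H_0: "1 \<in> H 0" and H_Suc: "\<And>m v p. v \<in> H 1 \<Longrightarrow> p \<in> H m \<Longrightarrow> v * p \<in> H (Suc m)"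
    and x: "x \<in> H 1" "A k x \<noteq> 0"
    and "finite S" "card S \<le> m" "k \<notin> S" "c k \<noteq> 0"
    and "\<And>i. i \<in> S \<Longrightarrow> \<exists>v\<in>H 1. \<exists>w\<in>H 1. A k v * A i w \<noteq> A k w * A i v"
  shows "\<exists>f\<in>H m. (\<Sum>i\<in>insert k S. c i * A i f) \<noteq> 0"
  using assms(7-)
proof (induction S arbitrary: c m rule: finite_induct)
  case empty
  \<comment> \<open>With \<open>k\<close> alone left, a power of \<open>x\<close> fills up the
    degree; its image is nonzero in a domain.\<close>
  have "x ^ m \<in> H m"
    by (induction m) (simp_all add: H_0 H_Suc x(1) del: One_nat_def)
  moreover have "A k (x ^ m) = A k x ^ m"
    by (induction m) (simp_all add: A_1 A_mult)
  ultimately show ?case using x empty by (intro bexI[of _ "x ^ m"]) simp_all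
next
  case (insert s S)
  obtain m' where m: "m = Suc m'" "card S \<le> m'"
    using insert.prems(1) insert.hyps by (cases m) auto
  obtain v w where vw: "v \<in> H 1" "w \<in> H 1" "A k v * A s w \<noteq> A k w * A s v"
    using insert.prems(4)[of s] by blast
  \<comment> \<open>Coefficients of the combination of the sums at \<open>v * f\<close> and
    \<open>w * f\<close> with factors \<open>A s w\<close> and \<open>- A s v\<close>. They vanish
    at \<open>s\<close>, and the choice of \<open>v\<close> and \<open>w\<close> keeps
    \<open>d k\<close> nonzero.\<close>
  define d where "d i = c i * (A i v * A s w - A i w * A s v)" for i
  have "\<exists>f\<in>H m'. (\<Sum>i\<in>insert k S. d i * A i f) \<noteq> 0"
    using insert.prems vw by (intro insert.IH m) (auto simp: d_def)
  then obtain f where f: "f \<in> H m'" "(\<Sum>i\<in>insert k S. d i * A i f) \<noteq> 0" by blast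
  have eq: "(\<Sum>i\<in>insert k S. d i * A i f) = (\<Sum>i\<in>insert k (insert s S). d i * A i f)"
    using insert by (intro sum.mono_neutral_left) (auto simp: d_def)
  have "(\<Sum>i\<in>insert k S. d i * A i f) =
      A s w * (\<Sum>i\<in>insert k (insert s S). c i * A i (v * f)) -
      A s v * (\<Sum>i\<in>insert k (insert s S). c i * A i (w * f))"
    unfolding eq sum_distrib_left sum_subtractf[symmetric]
    by (intro sum.cong refl) (simp add: d_def A_mult algebra_simps)
  with f(2) have "(\<Sum>i\<in>insert k (insert s S). c i * A i (v * f)) \<noteq> 0 \<or>
      (\<Sum>i\<in>insert k (insert s S). c i * A i (w * f)) \<noteq> 0"
    by auto
  moreover have "v * f \<in> H m" "w * f \<in> H m"
    using vw f(1) m(1) H_Suc by auto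
  ultimately show ?case by blast
qed

section \<open>The faithful representation and its action on polynomials\<close>

locale faithful_rep =
  fixes G :: "('g, 'h) monoid_scheme" (structure) and n :: nat
    and \<rho> :: "'g \<Rightarrow> 'a::field vec \<Rightarrow> 'a vec"
  assumes group_G: "group G" and finite_G: "finite (carrier G)" and n_pos: "1 \<le> n"
    and faithful_\<rho>: "faithful_FG_module class_ring G (vec_FG n \<rho>)"
begin

sublocale group G by (rule group_G)

sublocale rep: faithful_FG_module class_ring G "vec_FG n \<rho>" by (rule faithful_\<rho>)

lemma linear_endo: "g \<in> carrier G \<Longrightarrow> linear_endo n (\<rho> g)"
  using rep.act_linear[of g]
  by (auto simp: linear_endo_def LinearCombinations.module_hom_def vec_FG_simps)

lemmas rho_closed = linear_endo.closed[OF linear_endo]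

lemma rho_mult: "g \<in> carrier G \<Longrightarrow> h \<in> carrier G \<Longrightarrow> v \<in> carrier_vec n \<Longrightarrow> \<rho> (g \<otimes> h) v = \<rho> g (\<rho> h v)"
  using rep.composition_rule[of v g h] by (simp add: vec_FG_simps)

lemma rho_one: "v \<in> carrier_vec n \<Longrightarrow> \<rho> \<one> v = v"
  using fun_cong[OF rep.id_eq_one, of v] by (simp add: vec_FG_simps)

text \<open>Faithfulness is injectivity of \<open>\<rho>\<close> into functions; extensionality
  reduces equality of these functions to equality on \<open>carrier_vec n\<close>.\<close>

lemma rho_inj:
  assumes "g \<in> carrier G" "h \<in> carrier G" "\<And>v. v \<in> carrier_vec n \<Longrightarrow> \<rho> g v = \<rho> h v"
  shows "g = h"
proof -
  have "\<rho> g \<in> extensional (carrier_vec n)" "\<rho> h \<in> extensional (carrier_vec n)"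
    using rep.bij_prop0 assms by (auto simp: Bij_def vec_FG_simps)
  then have "\<rho> g = \<rho> h" using assms(3) by (rule extensionalityI)
  then show ?thesis using rep.faithful assms by (simp add: vec_FG_simps inj_on_def)
qed

text \<open>The action on the whole polynomial ring, not restricted to one degree, so that
  multiplicativity can be stated across degrees.\<close>

definition A :: "'g \<Rightarrow> 'a mpol \<Rightarrow> 'a mpol" where
  "A g = subst_vars (\<lambda>i. linear_form n (\<rho> g (unit_vec n i)))"

lemma A_linear_form: "g \<in> carrier G \<Longrightarrow> v \<in> carrier_vec n \<Longrightarrow> A g (linear_form n v) = linear_form n (\<rho> g v)"
  unfolding A_def by (rule linear_endo.subst_linear_form[OF linear_endo])

lemma A_add: "A g (p + q) = A g p + A g q"
  and A_mult: "A g (p * q) = A g p * A g q"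
  and A_1: "A g 1 = 1"
  and A_Const: "A g (Const c) = Const c"
  and A_sum: "A g (\<Sum>x\<in>X. f x) = (\<Sum>x\<in>X. A g (f x))"
  by (simp_all add: A_def subst_vars_add subst_vars_mult subst_vars_sum)

lemma A_homogeneous: "p \<in> homogeneous_polys n m \<Longrightarrow> A g p \<in> homogeneous_polys n m"
  unfolding A_def by (intro subst_vars_homogeneous linear_form_homogeneous)

lemma A_comp:
  assumes "g \<in> carrier G" "h \<in> carrier G" "p \<in> homogeneous_polys n m"
  shows "A (g \<otimes> h) p = A g (A h p)"
proof -
  have "A g (A h p) = subst_vars (\<lambda>i. A g (linear_form n (\<rho> h (unit_vec n i)))) p"
    unfolding A_def by (rule subst_vars_subst_vars)
  also have "\<dots> = A (g \<otimes> h) p"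
    unfolding A_def[of "g \<otimes> h"] using assms
    by (intro subst_vars_cong) (simp add: A_linear_form rho_mult rho_closed)
  finally show ?thesis by simp
qed

section \<open>The subgroup of scalar elements and its character\<close>

definition scalars :: "'g set" where
  "scalars = {g \<in> carrier G. \<exists>c. \<forall>v\<in>carrier_vec n. \<rho> g v = c \<cdot>\<^sub>v v}"

text \<open>On \<open>scalars\<close> the choice is forced, because \<open>n \<ge> 1\<close>;
  elsewhere the value is arbitrary.\<close>

definition \<chi> :: "'g \<Rightarrow> 'a" where
  "\<chi> g = (SOME c. \<forall>v\<in>carrier_vec n. \<rho> g v = c \<cdot>\<^sub>v v)"

lemma scalars_carrier: "z \<in> scalars \<Longrightarrow> z \<in> carrier G"
  by (simp add: scalars_def)

lemma rho_scalar: "z \<in> scalars \<Longrightarrow> v \<in> carrier_vec n \<Longrightarrow> \<rho> z v = \<chi> z \<cdot>\<^sub>v v"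
  unfolding scalars_def \<chi>_def by (metis (mono_tags, lifting) mem_Collect_eq someI_ex)

lemma \<chi>_unique:
  assumes "z \<in> carrier G" "\<And>v. v \<in> carrier_vec n \<Longrightarrow> \<rho> z v = c \<cdot>\<^sub>v v"
  shows "z \<in> scalars \<and> \<chi> z = c"
proof -
  have z: "z \<in> scalars" using assms by (auto simp: scalars_def)
  have "\<chi> z \<cdot>\<^sub>v unit_vec n 0 = c \<cdot>\<^sub>v (unit_vec n 0 :: 'a vec)"
    using rho_scalar[OF z] assms(2) by (metis unit_vec_carrier)
  then have "(\<chi> z \<cdot>\<^sub>v unit_vec n 0) $ 0 = (c \<cdot>\<^sub>v (unit_vec n 0 :: 'a vec)) $ 0" by simp
  then show ?thesis using z n_pos by simp
qed

lemma one_scalar: "\<one> \<in> scalars" "\<chi> \<one> = 1"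
  using \<chi>_unique[of \<one> 1] by (auto simp: rho_one)

lemma mult_scalar:
  assumes "z \<in> scalars" "y \<in> scalars"
  shows "z \<otimes> y \<in> scalars \<and> \<chi> (z \<otimes> y) = \<chi> z * \<chi> y"
  using assms by (intro \<chi>_unique) (auto simp: scalars_carrier rho_mult rho_scalar smult_smult_assoc)

lemma \<chi>_inj: "z \<in> scalars \<Longrightarrow> y \<in> scalars \<Longrightarrow> \<chi> z = \<chi> y \<Longrightarrow> z = y"
  by (rule rho_inj) (simp_all add: scalars_carrier rho_scalar)

lemma finite_scalars: "finite scalars"
  using finite_G by (rule rev_finite_subset) (auto simp: scalars_carrier)

lemma inv_scalar:
  assumes z: "z \<in> scalars"
  shows "inv z \<in> scalars \<and> \<chi> z * \<chi> (inv z) = 1"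
proof -
  have "\<chi> z \<cdot>\<^sub>v \<rho> (inv z) v = v" if v: "v \<in> carrier_vec n" for v
    using rho_scalar[OF z, of "\<rho> (inv z) v"] rho_mult[of z "inv z" v] z v
    by (simp add: scalars_carrier rho_closed rho_one)
  then have *: "\<rho> (inv z) v = inverse (\<chi> z) \<cdot>\<^sub>v v" if "v \<in> carrier_vec n" "\<chi> z \<noteq> 0" for v
    using that by (metis left_inverse one_smult_vec smult_smult_assoc)
  \<comment> \<open>Otherwise \<open>\<rho> z\<close> would kill every vector, yet it maps the
    translate of a unit vector by \<open>inv z\<close> back to that unit vector.\<close>
  have "\<chi> z \<noteq> 0"
  proof
    assume "\<chi> z = 0"
    have "\<rho> z (\<rho> (inv z) (unit_vec n 0)) = unit_vec n 0"
      using rho_mult[of z "inv z" "unit_vec n 0"] z by (simp add: scalars_carrier rho_one)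
    then have "0 \<cdot>\<^sub>v \<rho> (inv z) (unit_vec n 0) = (unit_vec n 0 :: 'a vec)"
      using rho_scalar[OF z, of "\<rho> (inv z) (unit_vec n 0)"] z \<open>\<chi> z = 0\<close>
      by (simp add: scalars_carrier rho_closed)
    then have "(0 \<cdot>\<^sub>v \<rho> (inv z) (unit_vec n 0)) $ 0 = (unit_vec n 0 :: 'a vec) $ 0" by simp
    moreover have "dim_vec (\<rho> (inv z) (unit_vec n 0)) = n"
      using rho_closed[of "inv z" "unit_vec n 0"] z by (simp add: scalars_carrier)
    ultimately show False using n_pos by simp
  qed
  then show ?thesis
    using \<chi>_unique[of "inv z" "inverse (\<chi> z)"] * z by (simp add: scalars_carrier)
qed

lemma subgroup_scalars: "subgroup scalars G"
  using mult_scalar inv_scalar one_scalar scalars_carrier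
  by (intro subgroup.intro) auto

text \<open>Every variable is multiplied by \<open>\<chi> z\<close>, so every monomial of degree
  \<open>m\<close> by its \<open>m\<close>-th power.\<close>

lemma A_scalar:
  assumes z: "z \<in> scalars" and p: "p \<in> homogeneous_polys n m"
  shows "A z p = Const (\<chi> z ^ m) * p"
proof -
  have "linear_form n (\<rho> z (unit_vec n i)) = Const (\<chi> z) * Var i" if "i < n" for i
  proof -
    have "linear_form n (\<rho> z (unit_vec n i)) = Const (\<chi> z) * linear_form n (unit_vec n i)"
      using rho_scalar[OF z, of "unit_vec n i"]
      by (simp add: linear_form_def sum_distrib_left Const_mult mult.assoc)
    then show ?thesis using that by (simp add: linear_form_unit)
  qed
  then have "A z p = subst_vars (\<lambda>i. Const (\<chi> z) * Var i) p"
    unfolding A_def using p by (intro subst_vars_cong) (auto simp: homogeneous_polys_def)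
  also have "\<dots> = (\<Sum>t\<in>Poly_Mapping.keys p. Const (\<chi> z ^ m) * (Const (Poly_Mapping.lookup p t) * monom_value Var t))"
    unfolding subst_vars_def
  proof (intro sum.cong refl)
    fix t assume t: "t \<in> Poly_Mapping.keys p"
    then have "Poly_Mapping.keys t \<subseteq> {..<n}" "(\<Sum>i<n. Poly_Mapping.lookup t i) = m"
      using p by (auto simp: homogeneous_polys_def)
    then have "(\<Sum>i\<in>Poly_Mapping.keys t. Poly_Mapping.lookup t i) = m"
      by (metis (no_types, lifting) DiffD2 finite_lessThan in_keys_iff sum.mono_neutral_left)
    then show "Const (Poly_Mapping.lookup p t) * monom_value (\<lambda>i. Const (\<chi> z) * Var i) t =
        Const (\<chi> z ^ m) * (Const (Poly_Mapping.lookup p t) * monom_value Var t)"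
      by (simp add: power_mult_distrib prod.distrib power_sum[symmetric] Const_power mult_ac)
  qed
  also have "\<dots> = Const (\<chi> z ^ m) * subst_vars Var p"
    by (simp add: subst_vars_def sum_distrib_left)
  finally show ?thesis by (simp add: subst_vars_id)
qed

section \<open>Character sums over the scalar subgroup\<close>

lemma bij_betw_mult_scalars: "z \<in> scalars \<Longrightarrow> bij_betw ((\<otimes>) z) scalars scalars"
  by (rule bij_betwI[where g = "(\<otimes>) (inv z)"])
    (simp_all add: mult_scalar inv_scalar scalars_carrier m_assoc[symmetric])

lemma \<chi>_nonzero: "z \<in> scalars \<Longrightarrow> \<chi> z \<noteq> 0"
  using inv_scalar[of z] by auto

text \<open>Translation by \<open>z\<close> permutes the factors of the product of all values of
  \<open>\<chi>\<close>, and this product can be cancelled. Periodicity in the degree comes from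
  here.\<close>

lemma \<chi>_power_card:
  assumes "z \<in> scalars"
  shows "\<chi> z ^ card scalars = 1"
proof -
  have "(\<Prod>y\<in>scalars. \<chi> y) = (\<Prod>y\<in>scalars. \<chi> (z \<otimes> y))"
    using prod.reindex_bij_betw[OF bij_betw_mult_scalars[OF assms], of \<chi>] by simp
  also have "\<dots> = \<chi> z ^ card scalars * (\<Prod>y\<in>scalars. \<chi> y)"
    using assms by (simp add: mult_scalar prod.distrib)
  finally show ?thesis
    using \<chi>_nonzero finite_scalars by simp
qed

text \<open>A geometric sum, with injectivity of \<open>\<chi>\<close> giving
  \<open>\<chi> z \<noteq> 1\<close> off the identity. It acts as an orthogonality relation with the
  exponent as summation variable.\<close>

lemma sum_\<chi>_power:
  assumes "z \<in> scalars"
  shows "(\<Sum>m<card scalars. \<chi> z ^ m) = (if z = \<one> then of_nat (card scalars) else 0)"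
proof (cases "z = \<one>")
  case False
  then have "\<chi> z \<noteq> 1" using \<chi>_inj[OF assms one_scalar(1)] one_scalar(2) by auto
  moreover have "(1 - \<chi> z) * (\<Sum>m<card scalars. \<chi> z ^ m) = 0"
    by (simp add: one_diff_power_eq[symmetric] \<chi>_power_card[OF assms])
  ultimately show ?thesis using False by simp
qed (simp add: one_scalar)

text \<open>Otherwise the polynomial \<open>1 + X + \<dots> + X\<^sup>N\<^sup>-\<^sup>1\<close>, \<open>N = card scalars\<close>, would vanish at
  all \<open>N\<close> values of \<open>\<chi>\<close>, including \<open>1\<close>.\<close>

lemma card_scalars_nonzero: "of_nat (card scalars) \<noteq> (0::'a)"
proof
  assume zero: "of_nat (card scalars) = (0::'a)"
  let ?N = "card scalars"
  have N: "0 < ?N" using finite_scalars one_scalar card_gt_0_iff by blast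
  define P :: "'a poly" where "P = (\<Sum>m<?N. Polynomial.monom 1 m)"
  have "poly P (\<chi> z) = 0" if "z \<in> scalars" for z
    using sum_\<chi>_power[OF that] zero by (simp add: P_def poly_sum poly_monom split: if_splits)
  then have "\<chi> ` scalars \<subseteq> {x. poly P x = 0}" by auto
  moreover have coeff: "coeff P i = (if i < ?N then 1 else 0)" for i
    by (simp add: P_def coeff_sum)
  then have "P \<noteq> 0" using N by (metis coeff_0 zero_neq_one)
  ultimately have "card (\<chi> ` scalars) \<le> card {x. poly P x = 0}"
    by (intro card_mono poly_roots_finite)
  also have "\<dots> \<le> degree P" by (rule card_poly_roots_bound[OF \<open>P \<noteq> 0\<close>])
  also have "degree P < ?N"
    using coeff N by (intro degree_lessI) auto
  finally show False
    using \<chi>_inj by (simp add: card_image inj_on_def)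
qed

text \<open>Summed over the whole window of exponents, these expressions add up to
  \<open>b \<one>\<close> times \<open>card scalars\<close>, which is nonzero; so one of them is
  nonzero.\<close>

lemma exists_nonzero_isotypic_sum:
  assumes "b \<one> \<noteq> 0"
  shows "\<exists>m\<in>{m0..<m0 + card scalars}. (\<Sum>z\<in>scalars. \<chi> (inv z) ^ m * b z) \<noteq> 0"
proof (rule ccontr)
  let ?N = "card scalars"
  assume "\<not> ?thesis"
  then have "0 = (\<Sum>m<?N. \<Sum>z\<in>scalars. \<chi> (inv z) ^ (m0 + m) * b z)"
    by (intro sum.neutral[symmetric]) auto
  also have "\<dots> = (\<Sum>z\<in>scalars. \<chi> (inv z) ^ m0 * b z * (\<Sum>m<?N. \<chi> (inv z) ^ m))"
    by (subst sum.swap) (simp add: power_add sum_distrib_left mult_ac)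
  also have "\<dots> = (\<Sum>z\<in>scalars. if z = \<one> then b \<one> * of_nat ?N else 0)"
    by (intro sum.cong refl) (auto simp: sum_\<chi>_power inv_scalar one_scalar scalars_carrier)
  also have "\<dots> = b \<one> * of_nat ?N"
    using finite_scalars one_scalar by simp
  finally show False using assms card_scalars_nonzero by simp
qed

section \<open>Cosets of the scalar subgroup and nonvanishing twisted sums\<close>

text \<open>If all these minors vanished, inserting forms translated by \<open>inv g\<close> would
  make \<open>h \<otimes> inv g\<close> act proportionally to the identity, hence as a
  scalar.\<close>

lemma exists_twisted_translate:
  assumes gh: "g \<in> carrier G" "h \<in> carrier G" "h \<otimes> inv g \<notin> scalars"
  shows "\<exists>v\<in>homogeneous_polys n 1. \<exists>w\<in>homogeneous_polys n 1. A g v * A h w \<noteq> A g w * A h v"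
proof (rule ccontr)
  assume contra: "\<not> ?thesis"
  let ?T = "\<rho> (h \<otimes> inv g)"
  interpret T: linear_endo n ?T using gh by (intro linear_endo) simp
  have "linear_form n v * linear_form n (?T w) = linear_form n w * linear_form n (?T v)"
    if vw: "v \<in> carrier_vec n" "w \<in> carrier_vec n" for v w
  proof -
    have *: "A g (linear_form n (\<rho> (inv g) u)) = linear_form n u"
      "A h (linear_form n (\<rho> (inv g) u)) = linear_form n (?T u)" if "u \<in> carrier_vec n" for u
      using that gh rho_mult[of g "inv g" u] rho_mult[of h "inv g" u]
      by (simp_all add: A_linear_form rho_closed rho_one)
    have "A g (linear_form n (\<rho> (inv g) v)) * A h (linear_form n (\<rho> (inv g) w)) =
        A g (linear_form n (\<rho> (inv g) w)) * A h (linear_form n (\<rho> (inv g) v))"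
      using contra linear_form_homogeneous by blast
    then show ?thesis using vw by (simp add: *)
  qed
  then have "\<exists>c. \<forall>v\<in>carrier_vec n. ?T v = c \<cdot>\<^sub>v v"
    using n_pos by (intro T.scalar_if_proportional) auto
  then show False using gh by (simp add: scalars_def)
qed

text \<open>The rule for \<open>c\<close> cancels the factor \<open>\<chi> z ^ m\<close> by which
  \<open>z\<close> acts in degree \<open>m\<close>, so the summands are constant on cosets. The sum
  is thus \<open>card scalars\<close> times a sum over representatives, to which
  \<open>dedekind_nonvanishing\<close> applies.\<close>

lemma exists_nonvanishing_twisted_sum:
  assumes m: "card (rcosets scalars) \<le> Suc m"
    and c: "\<And>z g. z \<in> scalars \<Longrightarrow> g \<in> carrier G \<Longrightarrow> c (z \<otimes> g) * \<chi> z ^ m = c g"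
    and g0: "g0 \<in> carrier G" "c g0 \<noteq> 0"
  shows "\<exists>f\<in>homogeneous_polys n m. (\<Sum>g\<in>carrier G. Const (c g) * A g f) \<noteq> 0"
proof -
  let ?R = "rcosets scalars"
  let ?k = "scalars #> g0"
  define rep where "rep C = (SOME g. g \<in> C)" for C :: "'g set"
  have rep: "rep C \<in> carrier G \<and> C = scalars #> rep C" if "C \<in> ?R" for C
  proof -
    from that obtain g where g: "g \<in> carrier G" "C = scalars #> g" by (auto simp: RCOSETS_def)
    then have "g \<in> C" using rcos_self subgroup_scalars by blast
    then have "rep C \<in> C" unfolding rep_def by (rule someI)
    then show ?thesis
      using g repr_independence[OF _ g(1) subgroup_scalars, of "rep C"] r_coset_subset_G[of scalars g]
        subgroup.subset[OF subgroup_scalars] by auto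
  qed
  have finite_R: "finite ?R"
    using finite_G by (simp add: RCOSETS_def)
  have k: "?k \<in> ?R" using g0 by (auto simp: RCOSETS_def)
  have const: "Const (c (z \<otimes> g)) * A (z \<otimes> g) f = Const (c g) * A g f"
    if "z \<in> scalars" "g \<in> carrier G" "f \<in> homogeneous_polys n m" for z g f
  proof -
    have "Const (c (z \<otimes> g)) * A (z \<otimes> g) f = Const (c (z \<otimes> g) * \<chi> z ^ m) * A g f"
      using that A_comp[of z g f m] A_scalar[of z "A g f" m]
      by (simp add: scalars_carrier A_homogeneous Const_mult mult.assoc)
    then show ?thesis using c that by simp
  qed
  \<comment> \<open>The coset of \<open>g0\<close> is singled out as the index with nonzero
    coefficient; one coset fewer remains, which matches the bound \<open>Suc m\<close>.\<close>
  have "\<exists>f\<in>homogeneous_polys n m. (\<Sum>C\<in>insert ?k (?R - {?k}). Const (c (rep C)) * A (rep C) f) \<noteq> 0"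
  proof (rule dedekind_nonvanishing[where x = "Var 0"])
    show "(Var 0 :: 'a mpol) \<in> homogeneous_polys n 1" using n_pos by (intro Var_homogeneous) simp
    \<comment> \<open>The inverse of the representative would carry a vanishing image back to
      \<open>Var 0\<close>.\<close>
    show "A (rep ?k) (Var 0 :: 'a mpol) \<noteq> 0"
    proof
      assume "A (rep ?k) (Var 0 :: 'a mpol) = 0"
      then have "A (inv rep ?k \<otimes> rep ?k) (Var 0 :: 'a mpol) = 0"
        using rep[OF k] A_comp[of "inv rep ?k" "rep ?k" "Var 0" 1] n_pos
        by (simp add: Var_homogeneous A_def[of "inv rep ?k"] del: One_nat_def)
      then have "A \<one> (Var 0 :: 'a mpol) = 0" using rep[OF k] by simp
      then have "Const (1 ^ 1) * (Var 0 :: 'a mpol) = 0"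
        using A_scalar[of \<one> "Var 0" 1] one_scalar n_pos
        by (simp add: Var_homogeneous del: One_nat_def)
      then show False by (simp add: Var_def) (metis lookup_single_eq lookup_zero zero_neq_one)
    qed
    show "card (?R - {?k}) \<le> m" using m k finite_R by simp
    show "Const (c (rep ?k)) \<noteq> 0"
    proof -
      have "g0 \<in> scalars #> rep ?k"
        using rcos_self[OF g0(1) subgroup_scalars] rep[OF k] by simp
      then obtain z where "z \<in> scalars" "g0 = z \<otimes> rep ?k" by (auto simp: r_coset_def)
      then have "c (rep ?k) \<noteq> 0"
        using c[of "z" "rep ?k"] rep[OF k] g0 \<chi>_nonzero[of z] by auto
      then show ?thesis by (simp add: Const_eq_0_iff)
    qed
    show "\<exists>v\<in>homogeneous_polys n 1. \<exists>w\<in>homogeneous_polys n 1.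
        A (rep ?k) v * A (rep C) w \<noteq> A (rep ?k) w * A (rep C) v" if "C \<in> ?R - {?k}" for C
    proof (rule exists_twisted_translate)
      show "rep C \<otimes> inv rep ?k \<notin> scalars"
      proof
        assume s: "rep C \<otimes> inv rep ?k \<in> scalars"
        have "rep C = (rep C \<otimes> inv rep ?k) \<otimes> rep ?k"
          using rep[OF k] rep[of C] that by (simp add: m_assoc)
        then have "rep C \<in> scalars #> rep ?k"
          using s unfolding r_coset_def by blast
        then have "scalars #> rep ?k = scalars #> rep C"
          using rep[OF k] by (intro repr_independence subgroup_scalars) auto
        then show False using rep[OF k] rep[of C] that by auto
      qed
    qed (use rep k that in auto)
    show "v * p \<in> homogeneous_polys n (Suc k)"
      if "v \<in> homogeneous_polys n 1" "p \<in> homogeneous_polys n k" for v p :: "'a mpol" and k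
      using homogeneous_polys_mult[OF that] by simp
  qed (use finite_R in \<open>simp_all add: A_1 A_mult one_homogeneous\<close>)
  then obtain f where f: "f \<in> homogeneous_polys n m"
    and nz: "(\<Sum>C\<in>?R. Const (c (rep C)) * A (rep C) f) \<noteq> 0"
    using insert_Diff[OF k] by auto
  have "(\<Sum>g\<in>carrier G. Const (c g) * A g f) = (\<Sum>C\<in>?R. \<Sum>g\<in>C. Const (c g) * A g f)"
  proof -
    have G: "carrier G = \<Union>?R" using rcosets_part_G[OF subgroup_scalars] by simp
    then have "\<forall>C\<in>?R. finite C" using finite_G by (metis Union_upper finite_subset)
    moreover have "\<forall>C\<in>?R. \<forall>D\<in>?R. C \<noteq> D \<longrightarrow> C \<inter> D = {}"
      using rcos_disjoint[OF subgroup_scalars] by (simp add: pairwise_def disjnt_def)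
    ultimately show ?thesis unfolding G by (simp add: sum.Union_disjoint)
  qed
  also have "\<dots> = (\<Sum>C\<in>?R. Const (of_nat (card scalars)) * (Const (c (rep C)) * A (rep C) f))"
  proof (intro sum.cong refl)
    fix C assume C: "C \<in> ?R"
    have "Const (c g) * A g f = Const (c (rep C)) * A (rep C) f" if "g \<in> C" for g
    proof -
      from that rep[OF C] obtain z where "z \<in> scalars" "g = z \<otimes> rep C"
        by (auto simp: r_coset_def)
      then show ?thesis using const rep[OF C] f by simp
    qed
    moreover have "card C = card scalars"
      using card_rcosets_equal[OF C] subgroup.subset[OF subgroup_scalars] by simp
    ultimately show "(\<Sum>g\<in>C. Const (c g) * A g f) =
        Const (of_nat (card scalars)) * (Const (c (rep C)) * A (rep C) f)"
      by (simp add: Const_def)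
  qed
  also have "\<dots> = Const (of_nat (card scalars)) * (\<Sum>C\<in>?R. Const (c (rep C)) * A (rep C) f)"
    by (simp add: sum_distrib_left)
  \<comment> \<open>Here the invertibility of \<open>card scalars\<close> in the field is
    essential.\<close>
  finally have "(\<Sum>g\<in>carrier G. Const (c g) * A g f) \<noteq> 0"
    using nz card_scalars_nonzero by (simp add: Const_eq_0_iff)
  with f show ?thesis by blast
qed

lemma act_Sym_FG: "p \<in> homogeneous_polys n m \<Longrightarrow> act (Sym_FG n m (vec_FG n \<rho>)) g p = A g p"
  by (simp add: Sym_FG_def A_def vec_FG_simps)

section \<open>Irreducible modules in symmetric powers\<close>

text \<open>One nonvanishing sum serves twice: it is the value at \<open>w0\<close> of an
  equivariant map into the symmetric power, and one of its coefficients certifies an equivariant map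
  in the other direction.\<close>

lemma iso_to_Sym_FG:
  fixes W :: "('a, 'g, 'w) fg_module"
  assumes W: "irreducible_FG_module class_ring G W" and w0: "w0 \<in> carrier W" "w0 \<noteq> \<zero>\<^bsub>W\<^esub>"
    and eigen: "\<And>z. z \<in> scalars \<Longrightarrow> act W z w0 = (\<chi> z ^ m) \<odot>\<^bsub>W\<^esub> w0"
    and m: "card (rcosets scalars) \<le> Suc m"
  shows "iso_to_submodule class_ring G W (Sym_FG n m (vec_FG n \<rho>))"
    and "iso_to_quotient class_ring G W (Sym_FG n m (vec_FG n \<rho>))"
proof -
  interpret W: irreducible_FG_module class_ring G W by (rule W)
  let ?S = "Sym_FG n m (vec_FG n \<rho>)"
  have smult_closed: "a \<odot>\<^bsub>W\<^esub> v \<in> carrier W" if "v \<in> carrier W" for a v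
    using W.smult_closed[of a v] that by simp
  obtain l :: "'w \<Rightarrow> 'a" where l1: "l w0 = 1"
    and l_add: "\<And>u v. u \<in> carrier W \<Longrightarrow> v \<in> carrier W \<Longrightarrow> l (u \<oplus>\<^bsub>W\<^esub> v) = l u + l v"
    and l_smult: "\<And>a v. v \<in> carrier W \<Longrightarrow> l (a \<odot>\<^bsub>W\<^esub> v) = a * l v"
    using exists_linear_functional[OF W.vectorspace_axioms w0] by blast
  have l_zero: "l \<zero>\<^bsub>W\<^esub> = 0"
    using l_smult[of "\<zero>\<^bsub>W\<^esub>" 0] W.lmult_0[of "\<zero>\<^bsub>W\<^esub>"] by simp
  \<comment> \<open>The eigenvector property of \<open>w0\<close> makes this matrix coefficient
    transform under \<open>scalars\<close> as the nonvanishing lemma demands.\<close>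
  define c where "c g = l (act W (inv g) w0)" for g
  have "c (z \<otimes> g) * \<chi> z ^ m = c g" if z: "z \<in> scalars" and g: "g \<in> carrier G" for z g
  proof -
    have "act W (inv (z \<otimes> g)) w0 = act W (inv g) (act W (inv z) w0)"
      using z g w0 by (simp add: scalars_carrier inv_mult_group W.composition_rule)
    also have "\<dots> = (\<chi> (inv z) ^ m) \<odot>\<^bsub>W\<^esub> act W (inv g) w0"
      using z g w0 by (simp add: eigen inv_scalar W.act_smult)
    finally have "c (z \<otimes> g) * \<chi> z ^ m = (\<chi> z * \<chi> (inv z)) ^ m * c g"
      using g w0 by (simp add: c_def l_smult W.act_closed power_mult_distrib)
    then show ?thesis using inv_scalar[OF z] by simp
  qed
  moreover have "c \<one> = 1"
    using w0 l1 fun_cong[OF W.id_eq_one, of w0] by (simp add: c_def)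
  ultimately obtain f where f: "f \<in> homogeneous_polys n m"
    and nz: "(\<Sum>g\<in>carrier G. Const (c g) * A g f) \<noteq> 0"
    using exists_nonvanishing_twisted_sum[OF m, of c \<one>] by auto
  show "iso_to_submodule class_ring G W ?S"
  proof (rule W.iso_to_submoduleI[OF vectorspace_Sym_FG _ _ w0(1)])
    define \<phi> where "\<phi> w = (\<Sum>g\<in>carrier G. Const (l (act W (inv g) w)) * A g f)" for w
    show "\<phi> w0 \<noteq> \<zero>\<^bsub>?S\<^esub>" using nz by (simp add: \<phi>_def c_def Sym_FG_simps)
    have \<phi>_closed: "\<phi> w \<in> homogeneous_polys n m" for w
      unfolding \<phi>_def by (intro homogeneous_polys_sum Const_mult_homogeneous A_homogeneous f)
    have "\<phi> (u \<oplus>\<^bsub>W\<^esub> v) = \<phi> u + \<phi> v" if "u \<in> carrier W" "v \<in> carrier W" for u v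
      unfolding \<phi>_def sum.distrib[symmetric] using that
      by (intro sum.cong refl) (simp add: W.act_add l_add W.act_closed Const_add distrib_right)
    moreover have "\<phi> (a \<odot>\<^bsub>W\<^esub> v) = Const a * \<phi> v" if "v \<in> carrier W" for a v
      unfolding \<phi>_def sum_distrib_left using that
      by (intro sum.cong refl) (simp add: W.act_smult l_smult W.act_closed Const_mult mult.assoc)
    ultimately show "\<phi> \<in> LinearCombinations.module_hom class_ring W ?S"
      using \<phi>_closed by (simp add: LinearCombinations.module_hom_def Sym_FG_simps)
    fix h w assume h: "h \<in> carrier G" and w: "w \<in> carrier W"
    \<comment> \<open>Replacing \<open>g\<close> by \<open>h \<otimes> g\<close> cancels
      \<open>h\<close> inside \<open>l\<close> and moves it in front of
      \<open>A g f\<close>.\<close>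
    have "bij_betw ((\<otimes>) h) (carrier G) (carrier G)"
      using h by (simp add: bij_betw_def inj_on_cmult surj_const_mult)
    then have "\<phi> (act W h w) =
        (\<Sum>g\<in>carrier G. Const (l (act W (inv (h \<otimes> g)) (act W h w))) * A (h \<otimes> g) f)"
      unfolding \<phi>_def by (rule sum.reindex_bij_betw[symmetric])
    also have "\<dots> = (\<Sum>g\<in>carrier G. Const (l (act W (inv g) w)) * A h (A g f))"
    proof (intro sum.cong refl)
      fix g assume g: "g \<in> carrier G"
      have "act W (inv (h \<otimes> g)) (act W h w) = act W (inv (h \<otimes> g) \<otimes> h) w"
        using g h w by (simp add: W.composition_rule)
      also have "inv (h \<otimes> g) \<otimes> h = inv g"
        using g h by (simp add: inv_mult_group m_assoc)
      finally show "Const (l (act W (inv (h \<otimes> g)) (act W h w))) * A (h \<otimes> g) f =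
          Const (l (act W (inv g) w)) * A h (A g f)"
        using A_comp[OF h g f] by simp
    qed
    also have "\<dots> = act ?S h (\<phi> w)"
      by (simp add: act_Sym_FG[OF \<phi>_closed]) (simp add: \<phi>_def A_sum A_mult A_Const)
    finally show "\<phi> (act W h w) = act ?S h (\<phi> w)" .
  qed
  obtain t where t: "Poly_Mapping.lookup (\<Sum>g\<in>carrier G. Const (c g) * A g f) t \<noteq> 0"
    using nz by (metis lookup_zero poly_mapping_eqI)
  show "iso_to_quotient class_ring G W ?S"
  proof (rule W.iso_to_quotientI[OF vectorspace_Sym_FG])
    \<comment> \<open>The parameter \<open>h\<close> allows for a translate by \<open>h\<close> of
      the summand at \<open>\<one>\<close>; the map \<open>\<psi>\<close> itself uses
      \<open>h = \<one>\<close>.\<close>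
    define s where "s p h g = Poly_Mapping.lookup (A g p) t \<odot>\<^bsub>W\<^esub> act W (h \<otimes> inv g) w0" for p h g
    have s_closed: "s p h \<in> carrier G \<rightarrow> carrier W" if "h \<in> carrier G" for p h
      using that w0 by (auto simp: s_def intro!: smult_closed W.act_closed)
    define \<psi> where "\<psi> p = finsum W (s p \<one>) (carrier G)" for p
    have \<psi>_closed: "\<psi> p \<in> carrier W" for p
      unfolding \<psi>_def by (intro W.finsum_closed s_closed) simp
    show "f \<in> carrier ?S" using f by (simp add: Sym_FG_simps)
    \<comment> \<open>Applying \<open>l\<close> turns \<open>\<psi> f\<close> into the coefficient
      at \<open>t\<close> of the nonvanishing sum.\<close>
    have "l (\<psi> f) = (\<Sum>g\<in>carrier G. l (s f \<one> g))"
      unfolding \<psi>_def by (rule W.additive_finsum[OF l_add l_zero s_closed]) simp_all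
    also have "\<dots> = Poly_Mapping.lookup (\<Sum>g\<in>carrier G. Const (c g) * A g f) t"
      unfolding lookup_sum using w0
      by (intro sum.cong refl) (simp add: s_def c_def l_smult W.act_closed lookup_Const_mult)
    finally show "\<psi> f \<noteq> \<zero>\<^bsub>W\<^esub>" using t l_zero by auto
    have "\<psi> (p + q) = \<psi> p \<oplus>\<^bsub>W\<^esub> \<psi> q" for p q
    proof -
      have "s (p + q) \<one> g = s p \<one> g \<oplus>\<^bsub>W\<^esub> s q \<one> g" if "g \<in> carrier G" for g
        using that w0 W.smult_l_distr[of _ _ "act W (\<one> \<otimes> inv g) w0"]
        by (simp add: s_def A_add lookup_add W.act_closed)
      then have "\<psi> (p + q) = finsum W (\<lambda>g. s p \<one> g \<oplus>\<^bsub>W\<^esub> s q \<one> g) (carrier G)"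
        unfolding \<psi>_def using s_closed[OF one_closed] by (intro W.finsum_cong') auto
      then show ?thesis
        unfolding \<psi>_def using W.finsum_addf[OF s_closed s_closed] by simp
    qed
    moreover have "\<psi> (Const a * p) = a \<odot>\<^bsub>W\<^esub> \<psi> p" for a p
    proof -
      have "s (Const a * p) \<one> g = a \<odot>\<^bsub>W\<^esub> s p \<one> g" if "g \<in> carrier G" for g
        using that w0 W.smult_assoc1[of a _ "act W (\<one> \<otimes> inv g) w0"]
        by (simp add: s_def A_mult A_Const lookup_Const_mult W.act_closed)
      then have "\<psi> (Const a * p) = finsum W (\<lambda>g. a \<odot>\<^bsub>W\<^esub> s p \<one> g) (carrier G)"
        unfolding \<psi>_def using s_closed[OF one_closed, of p]
        by (intro W.finsum_cong') (auto intro!: smult_closed)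
      then show ?thesis
        unfolding \<psi>_def using W.finsum_smult[of a "s p \<one>" "carrier G"] s_closed[OF one_closed, of p]
        by simp
    qed
    ultimately show "\<psi> \<in> LinearCombinations.module_hom class_ring ?S W"
      using \<psi>_closed by (simp add: LinearCombinations.module_hom_def Sym_FG_simps)
    show "act ?S g p \<in> carrier ?S" if "p \<in> carrier ?S" for g p
      using that by (simp add: Sym_FG_simps act_Sym_FG A_homogeneous)
    fix h p assume h: "h \<in> carrier G" and "p \<in> carrier ?S"
    then have p: "p \<in> homogeneous_polys n m" by (simp add: Sym_FG_simps)
    have "act W h (\<psi> p) = finsum W (\<lambda>g. act W h (s p \<one> g)) (carrier G)"
      unfolding \<psi>_def by (rule W.act_finsum[OF h s_closed[OF one_closed]])
    also have "\<dots> = finsum W (s p h) (carrier G)"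
    proof (rule W.finsum_cong'[OF refl s_closed[OF h]])
      fix g assume g: "g \<in> carrier G"
      then show "act W h (s p \<one> g) = s p h g"
        using h w0 by (simp add: s_def W.act_smult W.act_closed W.composition_rule)
    qed
    \<comment> \<open>Right translation by \<open>h\<close> moves the group element from the vector
      \<open>w0\<close> to the polynomial \<open>p\<close>.\<close>
    also have "\<dots> = finsum W (\<lambda>g. s p h (g \<otimes> h)) (carrier G)"
    proof -
      have inj: "inj_on (\<lambda>g. g \<otimes> h) (carrier G)" using h by (rule inj_on_multc)
      then have "(\<lambda>g. g \<otimes> h) ` carrier G = carrier G"
        using h finite_G by (intro endo_inj_surj) auto
      then show ?thesis
        using W.finsum_reindex[OF _ inj, of "s p h"] s_closed[OF h] by simp
    qed
    also have "\<dots> = \<psi> (A h p)"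
      unfolding \<psi>_def
    proof (rule W.finsum_cong'[OF refl s_closed[OF one_closed]])
      fix g assume g: "g \<in> carrier G"
      have "h \<otimes> inv (g \<otimes> h) = inv g"
        using g h by (simp add: inv_mult_group m_assoc[symmetric])
      then show "s p h (g \<otimes> h) = s (A h p) \<one> g"
        using g h A_comp[OF g h p] by (simp add: s_def)
    qed
    finally show "\<psi> (act ?S h p) = act W h (\<psi> p)"
      using p by (simp add: act_Sym_FG)
  qed
qed

text \<open>The twisted average of the translates of \<open>v\<close> over \<open>scalars\<close> is
  an eigenvector for the \<open>m\<close>-th power of \<open>\<chi>\<close>. A functional with
  \<open>l v = 1\<close> detects that it is nonzero for some \<open>m\<close> in the window.\<close>

lemma exists_eigenvector:
  fixes W :: "('a, 'g, 'w) fg_module"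
  assumes W: "irreducible_FG_module class_ring G W"
  shows "\<exists>m\<in>{m0..<m0 + card scalars}. \<exists>w\<in>carrier W. w \<noteq> \<zero>\<^bsub>W\<^esub> \<and>
    (\<forall>z\<in>scalars. act W z w = (\<chi> z ^ m) \<odot>\<^bsub>W\<^esub> w)"
proof -
  interpret W: irreducible_FG_module class_ring G W by (rule W)
  have smult_closed: "a \<odot>\<^bsub>W\<^esub> v \<in> carrier W" if "v \<in> carrier W" for a v
    using W.smult_closed[of a v] that by simp
  obtain v where v: "v \<in> carrier W" "v \<noteq> \<zero>\<^bsub>W\<^esub>"
    using W.nonzero W.zero_closed by blast
  obtain l :: "'w \<Rightarrow> 'a" where l1: "l v = 1"
    and l_add: "\<And>u v. u \<in> carrier W \<Longrightarrow> v \<in> carrier W \<Longrightarrow> l (u \<oplus>\<^bsub>W\<^esub> v) = l u + l v"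
    and l_smult: "\<And>a v. v \<in> carrier W \<Longrightarrow> l (a \<odot>\<^bsub>W\<^esub> v) = a * l v"
    using exists_linear_functional[OF W.vectorspace_axioms v] by blast
  have l_zero: "l \<zero>\<^bsub>W\<^esub> = 0"
    using l_smult[of "\<zero>\<^bsub>W\<^esub>" 0] W.lmult_0[of "\<zero>\<^bsub>W\<^esub>"] by simp
  have "l (act W \<one> v) \<noteq> 0"
    using v l1 fun_cong[OF W.id_eq_one, of v] by simp
  then obtain m where m: "m \<in> {m0..<m0 + card scalars}"
    and nz: "(\<Sum>z\<in>scalars. \<chi> (inv z) ^ m * l (act W z v)) \<noteq> 0"
    using exists_nonzero_isotypic_sum[of "\<lambda>z. l (act W z v)" m0] by blast
  define x where "x z = (\<chi> (inv z) ^ m) \<odot>\<^bsub>W\<^esub> act W z v" for z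
  have x_closed: "x \<in> scalars \<rightarrow> carrier W"
    using v by (auto simp: x_def intro!: smult_closed W.act_closed scalars_carrier)
  define w where "w = finsum W x scalars"
  have w: "w \<in> carrier W"
    unfolding w_def by (intro W.finsum_closed x_closed)
  have "l w = (\<Sum>z\<in>scalars. l (x z))"
    unfolding w_def by (rule W.additive_finsum[OF l_add l_zero x_closed])
  also have "\<dots> = (\<Sum>z\<in>scalars. \<chi> (inv z) ^ m * l (act W z v))"
    using v by (intro sum.cong refl) (simp add: x_def l_smult W.act_closed scalars_carrier)
  finally have "w \<noteq> \<zero>\<^bsub>W\<^esub>" using nz l_zero by auto
  moreover have "act W y w = (\<chi> y ^ m) \<odot>\<^bsub>W\<^esub> w" if y: "y \<in> scalars" for y
  proof -
    have "(\<lambda>z. (\<chi> y ^ m) \<odot>\<^bsub>W\<^esub> x z) \<in> scalars \<rightarrow> carrier W"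
      using x_closed smult_closed by auto
    moreover have "inj_on ((\<otimes>) y) scalars" "(\<otimes>) y ` scalars = scalars"
      using bij_betw_mult_scalars[OF y] by (auto simp: bij_betw_def)
    \<comment> \<open>Moving the summation variable by \<open>y\<close> is what makes the average an
      eigenvector of \<open>y\<close>.\<close>
    ultimately have reindex: "finsum W (\<lambda>z. (\<chi> y ^ m) \<odot>\<^bsub>W\<^esub> x z) scalars =
        finsum W (\<lambda>z. (\<chi> y ^ m) \<odot>\<^bsub>W\<^esub> x (y \<otimes> z)) scalars"
      using W.finsum_reindex[of "\<lambda>z. (\<chi> y ^ m) \<odot>\<^bsub>W\<^esub> x z" "(\<otimes>) y" scalars] by simp
    have "act W y w = finsum W (\<lambda>z. act W y (x z)) scalars"
      unfolding w_def by (rule W.act_finsum[OF scalars_carrier[OF y] x_closed])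
    also have "\<dots> = finsum W (\<lambda>z. (\<chi> y ^ m) \<odot>\<^bsub>W\<^esub> x (y \<otimes> z)) scalars"
    proof (rule W.finsum_cong'[OF refl])
      show "(\<lambda>z. (\<chi> y ^ m) \<odot>\<^bsub>W\<^esub> x (y \<otimes> z)) \<in> scalars \<rightarrow> carrier W"
        using x_closed y mult_scalar by (auto intro!: smult_closed)
      fix z assume z: "z \<in> scalars"
      have "\<chi> (inv (y \<otimes> z)) = \<chi> (inv z) * \<chi> (inv y)"
        using y z by (simp add: inv_mult_group scalars_carrier mult_scalar inv_scalar)
      then have "\<chi> y ^ m * \<chi> (inv (y \<otimes> z)) ^ m = \<chi> (inv z) ^ m * (\<chi> y * \<chi> (inv y)) ^ m"
        by (simp add: power_mult_distrib)
      then have "\<chi> y ^ m * \<chi> (inv (y \<otimes> z)) ^ m = \<chi> (inv z) ^ m"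
        using inv_scalar[OF y] by simp
      then show "act W y (x z) = (\<chi> y ^ m) \<odot>\<^bsub>W\<^esub> x (y \<otimes> z)"
        using v y z W.smult_assoc1[of "\<chi> y ^ m" "\<chi> (inv (y \<otimes> z)) ^ m" "act W (y \<otimes> z) v"]
        by (simp add: x_def W.act_smult W.act_closed scalars_carrier W.composition_rule)
    qed
    also have "\<dots> = (\<chi> y ^ m) \<odot>\<^bsub>W\<^esub> w"
      unfolding w_def reindex[symmetric]
      using W.finsum_smult[of "\<chi> y ^ m" x scalars] x_closed by simp
    finally show ?thesis .
  qed
  ultimately show ?thesis using m w by blast
qed

text \<open>Raising the degree by a multiple of the group order changes neither the eigenvalues
  \<open>\<chi> z ^ m\<close> nor the validity of the lower bound on the degree, so one eigenvector
  serves all \<open>k\<close>.\<close>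

lemma irreducible_in_Sym_FG_periodic:
  fixes W :: "('a, 'g, 'w) fg_module"
  assumes W: "irreducible_FG_module class_ring G W"
  shows "\<exists>m. 1 \<le> m \<and> m \<le> card (carrier G) \<and>
    (\<forall>k. iso_to_submodule class_ring G W (Sym_FG n (m + k * card (carrier G)) (vec_FG n \<rho>)) \<and>
      iso_to_quotient class_ring G W (Sym_FG n (m + k * card (carrier G)) (vec_FG n \<rho>)))"
proof -
  let ?N = "card scalars" and ?r = "card (rcosets scalars)"
  \<comment> \<open>The least positive degree in which the elimination over cosets has room; the
    maximum matters when there is a single coset.\<close>
  define m0 where "m0 = max 1 (?r - 1)"
  obtain m w where m: "m0 \<le> m" "m < m0 + ?N" and w: "w \<in> carrier W" "w \<noteq> \<zero>\<^bsub>W\<^esub>"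
    and eigen: "\<And>z. z \<in> scalars \<Longrightarrow> act W z w = (\<chi> z ^ m) \<odot>\<^bsub>W\<^esub> w"
    using exists_eigenvector[OF W, of m0] by auto
  have lagrange: "?r * ?N = card (carrier G)"
    using lagrange[OF subgroup_scalars] by (simp add: Coset.order_def)
  have "0 < card (carrier G)"
    using finite_G one_closed by (metis card_gt_0_iff empty_iff)
  then have "0 < ?r" "0 < ?N"
    using lagrange by (metis mult_0 mult_0_right neq0_conv)+
  \<comment> \<open>The window must end within the group order. For one coset equality holds;
    otherwise \<open>?r - 1 + ?N\<close> is compared with the product
    \<open>?r * ?N\<close>.\<close>
  have "m0 + ?N \<le> Suc (card (carrier G))"
  proof (cases "?r = 1")
    case True
    then show ?thesis using lagrange by (simp add: m0_def)
  next
    case False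
    with \<open>0 < ?r\<close> \<open>0 < ?N\<close> obtain a b where "?r = 2 + a" "?N = 1 + b"
      using le_Suc_ex[of 2 ?r] le_Suc_ex[of 1 ?N] by auto
    then show ?thesis unfolding lagrange[symmetric] by (simp add: m0_def algebra_simps)
  qed
  then have "m \<le> card (carrier G)" using m by simp
  moreover have "1 \<le> m" using m by (simp add: m0_def)
  moreover have "iso_to_submodule class_ring G W (Sym_FG n (m + k * card (carrier G)) (vec_FG n \<rho>)) \<and>
      iso_to_quotient class_ring G W (Sym_FG n (m + k * card (carrier G)) (vec_FG n \<rho>))" for k
  proof -
    have "\<chi> z ^ (m + k * card (carrier G)) = \<chi> z ^ m" if "z \<in> scalars" for z
    proof -
      have "\<chi> z ^ (m + k * card (carrier G)) = \<chi> z ^ m * (\<chi> z ^ ?N) ^ (k * ?r)"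
        unfolding lagrange[symmetric] by (simp add: power_add power_mult[symmetric] mult_ac)
      then show ?thesis using \<chi>_power_card[OF that] by simp
    qed
    moreover have "?r \<le> Suc (m + k * card (carrier G))"
    proof -
      have "?r - 1 \<le> m" using m by (simp add: m0_def)
      then show ?thesis by linarith
    qed
    ultimately show ?thesis
      using iso_to_Sym_FG[OF W w] eigen by simp
  qed
  ultimately show ?thesis by blast
qed

end

theorem theorem3:
  fixes G :: "('g, 'h) monoid_scheme"
    and n :: nat
    and \<rho> :: "'g \<Rightarrow> 'a::field vec \<Rightarrow> 'a vec"
    and W :: "('a, 'g, 'w) fg_module"
  assumes "group G" and "finite (carrier G)"
    and "n \<ge> 1"
    and "faithful_FG_module class_ring G (vec_FG n \<rho>)"
    and "irreducible_FG_module class_ring G W"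
  shows "\<exists>m. 1 \<le> m \<and> m \<le> card (carrier G) \<and>
           iso_to_submodule class_ring G W (Sym_FG n m (vec_FG n \<rho>)) \<and>
           iso_to_quotient class_ring G W (Sym_FG n m (vec_FG n \<rho>)) \<and>
           (\<forall>k. iso_to_submodule class_ring G W (Sym_FG n (m + k * card (carrier G)) (vec_FG n \<rho>)) \<and>
                iso_to_quotient class_ring G W (Sym_FG n (m + k * card (carrier G)) (vec_FG n \<rho>)))"
proof -
  interpret faithful_rep G n \<rho>
    using assms(1-4) by (rule faithful_rep.intro)
  obtain m where "1 \<le> m" "m \<le> card (carrier G)"
    and iso: "\<And>k. iso_to_submodule class_ring G W (Sym_FG n (m + k * card (carrier G)) (vec_FG n \<rho>)) \<and>
      iso_to_quotient class_ring G W (Sym_FG n (m + k * card (carrier G)) (vec_FG n \<rho>))"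
    using irreducible_in_Sym_FG_periodic[OF assms(5)] by blast
  \<comment> \<open>The case \<open>k = 0\<close> is degree \<open>m\<close> itself.\<close>
  then show ?thesis using iso[of 0] by auto
qed

end
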